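(* For all natural numbers $i<k$ there exists an unambiguous regular language $L$ of infinite trees (i.e. $L$ is recognised by some nondeterministic parity tree automaton that has at most one accepting run on every tree) such that $L$ cannot be recognised by any alternating parity tree automaton whose priorities all lie in $\{i,i+1,\ldots,k\}$. In other words, unambiguous tree languages do not lie in any fixed level $(i,k)$ of the parity (Rabin–Mostowski) index hierarchy of alternating automata.
   Context: Trees are over finite ranked alphabets: a tree over $A$ is a partial map $t:\omega^*\to A$ with non-empty prefix-closed domain such that a node labelled by an $m$-ary letter has exactly the children $u0,\ldots,u(m-1)$. A nondeterministic parity tree automaton has finitely many states, transitions $(q,a,q_0,\ldots,q_{m-1})$ for $m$-ary letters $a$, a set of initial states and a priority map; a run assigns states to nodes, starts in an initial state, respects transitions, and is accepting if on every branch the least priority occurring infinitely often is even. Alternating parity tree automata and the levels $(i,k)$ of the index hierarchy (languages recognised by alternating parity tree automata using priorities in $\{i,\ldots,k\}$) are the standard notions. *)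

theory Defs
  imports Main
begin

(* Ranked alphabet: letters are natural numbers from a finite set A, ar a is the arity of a.
   Nodes are lists of naturals; a tree is a partial map t :: nat list => nat option. *)

definition is_tree :: "nat set \<Rightarrow> (nat \<Rightarrow> nat) \<Rightarrow> (nat list \<Rightarrow> nat option) \<Rightarrow> bool" where
  "is_tree A ar t \<longleftrightarrow>
     t [] \<noteq> None \<and>
     (\<forall>u i. t (u @ [i]) \<noteq> None \<longrightarrow> t u \<noteq> None) \<and>
     (\<forall>u a. t u = Some a \<longrightarrow> a \<in> A \<and> (\<forall>i. t (u @ [i]) \<noteq> None \<longleftrightarrow> i < ar a))"

definition parity_acc :: "(nat \<Rightarrow> nat) \<Rightarrow> bool" where
  "parity_acc r \<longleftrightarrow> even (LEAST m. infinite {n. r n = m})"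

definition is_branch :: "(nat list \<Rightarrow> nat option) \<Rightarrow> (nat \<Rightarrow> nat) \<Rightarrow> bool" where
  "is_branch t \<beta> \<longleftrightarrow> (\<forall>n. t (map \<beta> [0..<n]) \<noteq> None)"

definition npta :: "nat set \<Rightarrow> (nat \<Rightarrow> nat) \<Rightarrow> nat set \<Rightarrow> (nat \<times> nat \<times> nat list) set
                     \<Rightarrow> nat set \<Rightarrow> (nat \<Rightarrow> nat) \<Rightarrow> bool" where
  "npta A ar Q \<Delta> I \<Omega> \<longleftrightarrow> finite Q \<and> I \<subseteq> Q \<and>
     (\<forall>(q, a, qs) \<in> \<Delta>. q \<in> Q \<and> a \<in> A \<and> length qs = ar a \<and> set qs \<subseteq> Q)"

definition npta_run :: "(nat \<Rightarrow> nat) \<Rightarrow> (nat \<times> nat \<times> nat list) set \<Rightarrow> nat set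
                         \<Rightarrow> (nat list \<Rightarrow> nat option) \<Rightarrow> (nat list \<Rightarrow> nat) \<Rightarrow> bool" where
  "npta_run ar \<Delta> I t \<rho> \<longleftrightarrow> \<rho> [] \<in> I \<and>
     (\<forall>u a. t u = Some a \<longrightarrow> (\<rho> u, a, map (\<lambda>i. \<rho> (u @ [i])) [0..<ar a]) \<in> \<Delta>)"

definition npta_acc_run :: "(nat \<Rightarrow> nat) \<Rightarrow> (nat \<times> nat \<times> nat list) set \<Rightarrow> nat set \<Rightarrow> (nat \<Rightarrow> nat)
                         \<Rightarrow> (nat list \<Rightarrow> nat option) \<Rightarrow> (nat list \<Rightarrow> nat) \<Rightarrow> bool" where
  "npta_acc_run ar \<Delta> I \<Omega> t \<rho> \<longleftrightarrow> npta_run ar \<Delta> I t \<rho> \<and>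
     (\<forall>\<beta>. is_branch t \<beta> \<longrightarrow> parity_acc (\<lambda>n. \<Omega> (\<rho> (map \<beta> [0..<n]))))"

definition npta_lang :: "nat set \<Rightarrow> (nat \<Rightarrow> nat) \<Rightarrow> (nat \<times> nat \<times> nat list) set \<Rightarrow> nat set
                         \<Rightarrow> (nat \<Rightarrow> nat) \<Rightarrow> (nat list \<Rightarrow> nat option) set" where
  "npta_lang A ar \<Delta> I \<Omega> = {t. is_tree A ar t \<and> (\<exists>\<rho>. npta_acc_run ar \<Delta> I \<Omega> t \<rho>)}"

definition npta_unambiguous :: "nat set \<Rightarrow> (nat \<Rightarrow> nat) \<Rightarrow> (nat \<times> nat \<times> nat list) set \<Rightarrow> nat set
                         \<Rightarrow> (nat \<Rightarrow> nat) \<Rightarrow> bool" where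
  "npta_unambiguous A ar \<Delta> I \<Omega> \<longleftrightarrow>
     (\<forall>t \<rho>1 \<rho>2. is_tree A ar t \<and> npta_acc_run ar \<Delta> I \<Omega> t \<rho>1 \<and> npta_acc_run ar \<Delta> I \<Omega> t \<rho>2
        \<longrightarrow> (\<forall>u. t u \<noteq> None \<longrightarrow> \<rho>1 u = \<rho>2 u))"

(* ---------- alternating parity tree automata ----------
   delta q a is a positive Boolean formula over {0..<ar a} x Q, given in disjunctive normal
   form as a finite set of sets of (direction, state) pairs (true = {{}}, false = {}). *)

definition apta :: "nat set \<Rightarrow> (nat \<Rightarrow> nat) \<Rightarrow> nat set \<Rightarrow> (nat \<Rightarrow> nat \<Rightarrow> (nat \<times> nat) set set)
                     \<Rightarrow> nat \<Rightarrow> (nat \<Rightarrow> nat) \<Rightarrow> bool" where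
  "apta A ar Q \<delta> q0 \<Omega> \<longleftrightarrow> finite Q \<and> q0 \<in> Q \<and>
     (\<forall>q\<in>Q. \<forall>a\<in>A. finite (\<delta> q a) \<and> (\<forall>S\<in>\<delta> q a. S \<subseteq> {0..<ar a} \<times> Q))"

(* acceptance game: at position (u,q) Eve picks a disjunct S of delta q (t u), then Adam picks
   (d,q') in S and the play moves to (u@[d], q').  Eve's strategy sigma maps finite histories
   to her choice. *)

definition apta_hist :: "((nat list \<times> nat) list \<Rightarrow> (nat \<times> nat) set) \<Rightarrow> nat
                          \<Rightarrow> (nat list \<times> nat) list \<Rightarrow> bool" where
  "apta_hist \<sigma> q0 h \<longleftrightarrow> h \<noteq> [] \<and> hd h = ([], q0) \<and>
     (\<forall>j. Suc j < length h \<longrightarrow>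
        (\<exists>d q'. h ! Suc j = (fst (h ! j) @ [d], q') \<and> (d, q') \<in> \<sigma> (take (Suc j) h)))"

definition apta_winning :: "(nat \<Rightarrow> nat \<Rightarrow> (nat \<times> nat) set set) \<Rightarrow> nat \<Rightarrow> (nat \<Rightarrow> nat)
                 \<Rightarrow> (nat list \<Rightarrow> nat option) \<Rightarrow> ((nat list \<times> nat) list \<Rightarrow> (nat \<times> nat) set) \<Rightarrow> bool" where
  "apta_winning \<delta> q0 \<Omega> t \<sigma> \<longleftrightarrow>
     (\<forall>h. apta_hist \<sigma> q0 h \<longrightarrow> \<sigma> h \<in> \<delta> (snd (last h)) (the (t (fst (last h))))) \<and>
     (\<forall>p. p 0 = ([], q0) \<and>
          (\<forall>n. \<exists>d q'. p (Suc n) = (fst (p n) @ [d], q') \<and> (d, q') \<in> \<sigma> (map p [0..<Suc n]))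
        \<longrightarrow> parity_acc (\<lambda>n. \<Omega> (snd (p n))))"

definition apta_lang :: "nat set \<Rightarrow> (nat \<Rightarrow> nat) \<Rightarrow> (nat \<Rightarrow> nat \<Rightarrow> (nat \<times> nat) set set) \<Rightarrow> nat
                          \<Rightarrow> (nat \<Rightarrow> nat) \<Rightarrow> (nat list \<Rightarrow> nat option) set" where
  "apta_lang A ar \<delta> q0 \<Omega> = {t. is_tree A ar t \<and> (\<exists>\<sigma>. apta_winning \<delta> q0 \<Omega> t \<sigma>)}"

end

theory Submission
  imports Defs "HOL-Library.Infinite_Set"
begin

text \<open>
  Parity games are encoded as ternary trees: besides the two successors of a position, a node has a
  middle subtree, and the owner of the position moves to the left successor iff he wins the game
  encoded by the middle subtree. An automaton that guesses the winner of the subtrees it visits is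
  unambiguous: accepting runs for both players on the same subtree would yield a play won by both,
  and two different accepting runs for the same player disagree about the winner of a middle subtree.

  For hardness, every parity game has to be enriched by middle subtrees such that the strategies they
  prescribe are winning. A winning strategy with memory is obtained by always moving to a position
  whose rank, with respect to the most important bad priority, is smaller than that of the
  last position where this priority was seen. Ranks are compared by a game on two boards, played
  alternately, in which the least priority marks a change of board; lowering the priorities by
  one on the board with exchanged roles, the comparison game needs no new priorities. The
  comparison games are enriched in the same way, by corecursion. Finally, an alternating automaton of
  bounded index for the language is refuted by diagonalisation, on a tree that encodes the
  acceptance game of the automaton on that very tree, with the roles of the players exchanged.
\<close>

section \<open>Fixed points and ranks\<close>

text \<open>Knowing the winning region is not enough for moving: a play may stay inside it forever
  and still be lost. This is why ranks must enter the middle subtrees. Nor may the enrichment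
  consult the winners, although they could be chosen classically: the winner of the diagonal game
  depends on the very tree that is being built. Labels and subtrees are therefore computed from
  terms without \<open>val\<close>, the contexts of both players are carried along, and every
  question is posed as a game. The regress of tests inside tests is harmless, because
  \<open>val\<close> is defined by plays along \<open>nx\<close> and ignores the enrichment. Role
  exchanges come from races: a test reached on the exchanged board has to give the opposite verdict.
  Priority 0 is reserved for them; a state priority \<open>m\<close> becomes \<open>m + 1\<close>,
  which also compensates for the exchanged roles in the acceptance game; one neutral priority above
  all of these serves the intermediate choices. Hence \<open>n = k + 2\<close>.\<close>

inductive_set stages :: "('a set \<Rightarrow> 'a set) \<Rightarrow> 'a set set" for f where
  stages_step: "Y \<in> stages f \<Longrightarrow> f Y \<in> stages f"
| stages_Union: "(\<And>Y. Y \<in> M \<Longrightarrow> Y \<in> stages f) \<Longrightarrow> \<Union>M \<in> stages f"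

lemma stages_subset:
  assumes "mono f" "Y \<in> stages f"
  shows "Y \<subseteq> f Y"
  using assms(2)
proof induction
  case (stages_step Y)
  then show ?case using assms(1) by (simp add: monoD)
next
  case (stages_Union M)
  have "Y \<subseteq> f (\<Union>M)" if "Y \<in> M" for Y
    using stages_Union[OF that] monoD[OF assms(1), of Y "\<Union>M"] that by blast
  then show ?case by blast
qed

lemma stages_subset_lfp:
  assumes "mono f" "Y \<in> stages f"
  shows "Y \<subseteq> lfp f"
  using assms(2)
proof induction
  case (stages_step Y)
  then show ?case using assms(1) lfp_unfold[OF assms(1)] by (metis monoD)
qed blast

text \<open>The stages are the transfinite iterates of \<open>f\<close> from the empty set (the
  empty union). The Bourbaki-Witt argument shows without ordinals that they form a chain: no step
  from a smaller stage jumps over an \<open>extreme\<close> one.\<close>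

lemma stages_comparable:
  assumes f: "mono f" and "Y \<in> stages f" "Y' \<in> stages f"
  shows "Y' \<subseteq> Y \<or> f Y \<subseteq> Y'"
proof -
  define extreme where "extreme Y \<longleftrightarrow> (\<forall>Z\<in>stages f. Z \<subset> Y \<longrightarrow> f Z \<subseteq> Y)" for Y
  have ext: "Z \<subseteq> Y \<or> f Y \<subseteq> Z" if "extreme Y" "Z \<in> stages f" for Y Z
    using that(2)
  proof induction
    case (stages_step Z)
    then show ?case
      using that(1) stages_subset[OF f, of Z] by (auto simp: extreme_def)
  qed blast
  have "extreme Y" using assms(2)
  proof induction
    case (stages_step Y)
    show ?case unfolding extreme_def
    proof (intro ballI impI)
      fix Z assume "Z \<in> stages f" "Z \<subset> f Y"
      then have "Z \<subseteq> Y" using ext[of Y Z] stages_step by auto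
      then show "f Z \<subseteq> f Y" by (rule monoD[OF f])
    qed
  next
    case (stages_Union M)
    show ?case unfolding extreme_def
    proof (intro ballI impI)
      fix Z assume Z: "Z \<in> stages f" "Z \<subset> \<Union>M"
      then obtain Y where Y: "Y \<in> M" "\<not> Y \<subseteq> Z" by blast
      then have "Z \<subset> Y"
        using ext[of Y Z] stages_Union Z(1) stages_subset[OF f, of Y] by blast
      then show "f Z \<subseteq> \<Union>M"
        using stages_Union.IH[OF Y(1)] Z(1) Y(1) by (auto simp: extreme_def)
    qed
  qed
  then show ?thesis using ext assms(3) by blast
qed

text \<open>The largest stage avoiding \<open>y\<close>: the elements of smaller rank, with rank
  infinity outside \<open>lfp f\<close>. For monotone \<open>f\<close>, membership of
  \<open>x\<close> in \<open>f (below f y)\<close> says that \<open>x\<close> has a rank, at most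
  that of \<open>y\<close>.\<close>

definition below :: "('a set \<Rightarrow> 'a set) \<Rightarrow> 'a \<Rightarrow> 'a set" where
  "below f y = \<Union>{Y \<in> stages f. y \<notin> Y}"

lemma below_stage: "below f y \<in> stages f"
  unfolding below_def by (rule stages_Union) blast

lemma not_below_self: "y \<notin> below f y"
  by (auto simp: below_def)

lemma stage_subset_below: "Y \<in> stages f \<Longrightarrow> y \<notin> Y \<Longrightarrow> Y \<subseteq> below f y"
  by (auto simp: below_def)

lemma below_subset_lfp: "mono f \<Longrightarrow> below f y \<subseteq> lfp f"
  by (rule stages_subset_lfp[OF _ below_stage])

lemma lfp_in_step_below:
  assumes "mono f" "y \<in> lfp f"
  shows "y \<in> f (below f y)"
proof (rule ccontr)
  assume "y \<notin> f (below f y)"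
  then have "f (below f y) \<subseteq> below f y"
    by (intro stage_subset_below stages_step below_stage)
  then have "lfp f \<subseteq> below f y" by (rule lfp_lowerbound)
  then show False using assms(2) not_below_self[of y f] by blast
qed

lemma below_not_step:
  assumes "mono f" "x \<in> below f y"
  shows "y \<notin> f (below f x)"
proof -
  obtain Y where Y: "Y \<in> stages f" "x \<in> Y" "y \<notin> Y"
    using assms(2) by (auto simp: below_def)
  then have "f (below f x) \<subseteq> Y"
    using stages_comparable[OF assms(1) below_stage Y(1), of x] Y(2) not_below_self[of x f] by blast
  then show ?thesis using Y(3) by blast
qed

lemma not_below_step:
  assumes "mono f" "x \<in> lfp f" "y \<notin> below f x"
  shows "x \<in> f (below f y)"
proof -
  have "below f x \<subseteq> below f y" using assms(3) by (intro stage_subset_below below_stage)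
  then show ?thesis using lfp_in_step_below[OF assms(1,2)] monoD[OF assms(1)] by blast
qed

lemma below_step_trans:
  assumes "mono f" "x \<in> below f y" "y \<in> f (below f z)"
  shows "z \<notin> f (below f x)"
proof
  assume z: "z \<in> f (below f x)"
  then have "x \<notin> below f z" using below_not_step[OF assms(1)] by blast
  then have "below f z \<subseteq> below f x" by (intro stage_subset_below below_stage)
  then have "y \<in> f (below f x)" using assms(3) monoD[OF assms(1)] by blast
  then show False using below_not_step[OF assms(1,2)] by blast
qed

lemma wf_below:
  assumes f: "mono f"
  shows "wf {(x, y). x \<in> below f y}"
proof -
  let ?R = "{(x, y). x \<in> below f y}"
  have stage_acc: "Y \<subseteq> Wellfounded.acc ?R" if "Y \<in> stages f" for Y
    using that
  proof induction
    case (stages_step Y)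
    show ?case
    proof
      fix y assume y: "y \<in> f Y"
      show "y \<in> Wellfounded.acc ?R"
      proof (rule accI)
        fix x assume "(x, y) \<in> ?R"
        then obtain Z where "Z \<in> stages f" "x \<in> Z" "y \<notin> Z" by (auto simp: below_def)
        then have "x \<in> Y" using stages_comparable[OF f stages_step(1), of Z] y by blast
        then show "x \<in> Wellfounded.acc ?R" using stages_step by blast
      qed
    qed
  qed blast
  have "y \<in> Wellfounded.acc ?R" for y
  proof (rule accI)
    fix x assume "(x, y) \<in> ?R"
    then show "x \<in> Wellfounded.acc ?R" using stage_acc[OF below_stage, of y] by blast
  qed
  then show ?thesis by (simp add: wf_iff_acc)
qed

section \<open>Duality of fixed points and their transfer along injections\<close>

definition fixpt :: "bool \<Rightarrow> ('a set \<Rightarrow> 'a set) \<Rightarrow> 'a set" where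
  "fixpt b f = (if b then gfp f else lfp f)"

lemma fixpt_unfold: "mono f \<Longrightarrow> fixpt b f = f (fixpt b f)"
  using gfp_unfold[of f] lfp_unfold[of f] by (auto simp: fixpt_def)

lemma fixpt_mono: "(\<And>Z. f Z \<subseteq> g Z) \<Longrightarrow> fixpt b f \<subseteq> fixpt b g"
  by (auto simp: fixpt_def intro: lfp_mono[THEN subsetD] gfp_mono[THEN subsetD])

lemma Compl_lfp:
  fixes f :: "'a set \<Rightarrow> 'a set"
  assumes "mono f"
  shows "- lfp f = gfp (\<lambda>Z. - f (- Z))"
proof (rule antisym)
  have m: "mono (\<lambda>Z. - f (- Z))"
    using monoD[OF assms] by (intro monoI) (meson Compl_subset_Compl_iff)
  show "- lfp f \<subseteq> gfp (\<lambda>Z. - f (- Z))"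
    by (rule gfp_upperbound) (simp add: lfp_fixpoint[OF assms])
  have "lfp f \<subseteq> - gfp (\<lambda>Z. - f (- Z))"
    by (rule lfp_lowerbound) (use gfp_fixpoint[OF m] in auto)
  then show "gfp (\<lambda>Z. - f (- Z)) \<subseteq> - lfp f" by blast
qed

lemma Compl_fixpt:
  assumes "mono f"
  shows "- fixpt b f = fixpt (\<not> b) (\<lambda>Z. - f (- Z))"
proof -
  have "mono (\<lambda>Z. - f (- Z))"
    using monoD[OF assms] by (intro monoI) (meson Compl_subset_Compl_iff)
  from Compl_lfp[OF this] Compl_lfp[OF assms] show ?thesis
    by (cases b) (simp_all add: fixpt_def, metis double_compl)
qed

lemma vimage_fixpt:
  assumes h: "inj h" and f: "mono f" and g: "mono g"
    and hfg: "\<And>Z. h -` f Z = g (h -` Z)"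
  shows "h -` fixpt b f = fixpt b g"
proof (cases b)
  case False
  \<comment> \<open>This is the largest set with preimage \<open>lfp g\<close>; points outside the
    range of \<open>h\<close> cannot violate the prefixed-point condition.\<close>
  have "lfp f \<subseteq> - h ` (- lfp g)"
  proof (rule lfp_lowerbound)
    have "h -` f (- h ` (- lfp g)) = lfp g"
      using h by (simp add: hfg vimage_Compl inj_vimage_image_eq lfp_fixpoint[OF g])
    then show "f (- h ` (- lfp g)) \<subseteq> - h ` (- lfp g)" by blast
  qed
  moreover have "lfp g \<subseteq> h -` lfp f"
    by (rule lfp_lowerbound) (simp add: hfg[symmetric] lfp_fixpoint[OF f])
  ultimately show ?thesis using False h by (auto simp: fixpt_def)
next
  case True
  have "h ` gfp g \<subseteq> gfp f"
  proof (rule gfp_upperbound)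
    have "h -` f (h ` gfp g) = gfp g"
      using h by (simp add: hfg inj_vimage_image_eq gfp_fixpoint[OF g])
    then show "h ` gfp g \<subseteq> f (h ` gfp g)" by blast
  qed
  moreover have "h -` gfp f \<subseteq> gfp g"
    by (rule gfp_upperbound) (simp add: hfg[symmetric] gfp_fixpoint[OF f])
  ultimately show ?thesis using True by (auto simp: fixpt_def)
qed

section \<open>Parity games by nested fixed points\<close>

locale parity_game =
  fixes own :: "'a \<Rightarrow> bool" and pr :: "'a \<Rightarrow> nat" and nx :: "bool \<Rightarrow> 'a \<Rightarrow> 'a" and N :: nat
  assumes pr_less: "pr x < N"
begin

definition pre :: "bool \<Rightarrow> 'a set \<Rightarrow> 'a set" where
  "pre s X = {x. if own x = s then \<exists>b. nx b x \<in> X else \<forall>b. nx b x \<in> X}"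

text \<open>\<open>win s p X\<close> is the set of positions from which player \<open>s\<close> wins (\<open>True\<close> is Eve, who
  wants the least priority seen infinitely often to be even) the game that, after the first move,
  stops at the first position of priority below \<open>p\<close> and is then won iff that position lies in \<open>X\<close>.
  The priority of the initial position is ignored. Being given by nested fixed points, these games
  are determined by mere complementation.\<close>

definition split_at :: "nat \<Rightarrow> 'a set \<Rightarrow> 'a set \<Rightarrow> 'a set" where
  "split_at p X Z = {c. if pr c = p then c \<in> Z else c \<in> X}"

primrec win_upto :: "bool \<Rightarrow> nat \<Rightarrow> 'a set \<Rightarrow> 'a set" where
  "win_upto s 0 X = pre s X"
| "win_upto s (Suc d) X = fixpt (even (N - d) = s) (\<lambda>Z. win_upto s d (split_at (N - d) X Z))"

definition win :: "bool \<Rightarrow> nat \<Rightarrow> 'a set \<Rightarrow> 'a set" where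
  "win s p X = win_upto s (Suc N - p) X"

definition lev :: "bool \<Rightarrow> nat \<Rightarrow> 'a set \<Rightarrow> 'a set \<Rightarrow> 'a set" where
  "lev s p X Z = win s (Suc p) (split_at p X Z)"

lemma win_top: "win s (Suc N) X = pre s X"
  by (simp add: win_def)

lemma win_fixpt: "p \<le> N \<Longrightarrow> win s p X = fixpt (even p = s) (lev s p X)"
  by (simp add: win_def lev_def[abs_def] Suc_diff_le)

lemma win_induct [consumes 1, case_names top level]:
  assumes "p \<le> Suc N"
    and "P (Suc N)"
    and "\<And>p. p \<le> N \<Longrightarrow> P (Suc p) \<Longrightarrow> P p"
  shows "P p"
  using assms(1) by (induction rule: inc_induct) (use assms in auto)

lemma win_mono:
  assumes "p \<le> Suc N" "\<And>c. pr c < p \<Longrightarrow> c \<in> X \<Longrightarrow> c \<in> Y"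
  shows "win s p X \<subseteq> win s p Y"
  using assms
proof (induction arbitrary: X Y rule: win_induct)
  case top
  then have "X \<subseteq> Y" by (meson pr_less less_SucI subsetI)
  then show ?case by (auto simp: win_top pre_def)
next
  case (level p)
  have "lev s p X Z \<subseteq> lev s p Y Z" for Z
    unfolding lev_def using level.prems by (intro level.IH) (auto simp: split_at_def split: if_splits)
  then show ?case using level.hyps by (simp add: win_fixpt fixpt_mono)
qed

lemma win_cong:
  assumes "p \<le> Suc N" "\<And>c. pr c < p \<Longrightarrow> c \<in> X \<longleftrightarrow> c \<in> Y"
  shows "win s p X = win s p Y"
  using assms win_mono[of p X Y] win_mono[of p Y X] by blast

lemma mono_lev: "p \<le> N \<Longrightarrow> mono (lev s p X)"
  unfolding lev_def by (intro monoI win_mono) (auto simp: split_at_def split: if_splits)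

lemma win_lev: "p \<le> N \<Longrightarrow> win s p X = lev s p X (win s p X)"
  using fixpt_unfold[OF mono_lev] by (simp add: win_fixpt)

text \<open>A game stopping below \<open>p\<close> may be interrupted at any priority below
  \<open>q\<close>, provided that the verdict at an interruption from \<open>p\<close> on is that of
  the game resumed there.\<close>

lemma win_unfold:
  assumes "p \<le> q" "q \<le> Suc N"
  shows "win s p X = win s q {c. if pr c < p then c \<in> X else c \<in> win s p X}"
  using assms
proof (induction q rule: dec_induct)
  case base
  show ?case using base by (intro win_cong) auto
next
  case (step q)
  let ?V = "{c. if pr c < p then c \<in> X else c \<in> win s p X}"
  have "win s p X = win s q ?V" using step by simp
  also have "\<dots> = win s (Suc q) (split_at q ?V (win s q ?V))"
    using win_lev[of q s ?V] step.prems by (simp add: lev_def)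
  also have "split_at q ?V (win s q ?V) = ?V"
    using step by (auto simp: split_at_def)
  finally show ?case .
qed

lemma win_pre: "p \<le> Suc N \<Longrightarrow> win s p X = pre s {c. if pr c < p then c \<in> X else c \<in> win s p X}"
  using win_unfold[of p "Suc N"] by (simp add: win_top)

lemma win_Compl: "p \<le> Suc N \<Longrightarrow> win (\<not> s) p (- X) = - win s p X"
proof (induction arbitrary: X rule: win_induct)
  case top
  then show ?case by (auto simp: win_top pre_def)
next
  case (level p)
  have *: "split_at p (- X) Z = - split_at p X (- Z)" for Z by (auto simp: split_at_def)
  have "lev (\<not> s) p (- X) Z = - lev s p X (- Z)" for Z
    unfolding lev_def * by (rule level.IH)
  then have "lev (\<not> s) p (- X) = (\<lambda>Z. - lev s p X (- Z))" by blast
  then show ?case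
    using Compl_fixpt[OF mono_lev[OF level.hyps], of "even p = s" s X] level.hyps
    by (auto simp: win_fixpt)
qed

text \<open>The map \<open>h\<close> embeds a board into the game; if \<open>f\<close> holds, the players are exchanged and all
  priorities are lowered by one, which keeps the range of priorities bounded.\<close>

lemma win_transfer:
  assumes "inj h"
    and own: "\<And>x. own (h x) = (own x \<noteq> f)"
    and nx: "\<And>b x. nx b (h x) = k (nx b x)"
    and "p + of_bool f \<le> Suc N"
    and "\<And>c. pr c < p + of_bool f \<Longrightarrow> pr (k c) < p"
    and "\<And>c. p + of_bool f \<le> pr c \<Longrightarrow> k c = h c \<and> pr (h c) + of_bool f = pr c"
  shows "h x \<in> win s p Y \<longleftrightarrow> x \<in> win (s \<noteq> f) (p + of_bool f) {c. k c \<in> Y}"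
proof -
  define d where "d = Suc N - (p + of_bool f)"
  have "h -` win s p Y = win (s \<noteq> f) (p + of_bool f) {c. k c \<in> Y}"
    using assms(4-6) d_def
  proof (induction d arbitrary: p Y)
    case 0
    \<comment> \<open>Here every move leaves the board. With exchanged roles \<open>p\<close> is
      \<open>N\<close> and not \<open>Suc N\<close>, so that side is reduced to one move by
      \<open>win_pre\<close>.\<close>
    then have top: "p + of_bool f = Suc N" by simp
    have "pr (k c) < p" for c using 0 pr_less[of c] by simp
    moreover have "p \<le> Suc N" using top by linarith
    ultimately show ?case
      unfolding top win_top by (subst win_pre) (auto simp: pre_def own nx)
  next
    case (Suc d)
    let ?p = "p + of_bool f" and ?s = "s \<noteq> f"
    have p: "?p \<le> N" "p \<le> N" using Suc by (auto simp: of_bool_def split: if_splits)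
    have "h -` lev s p Y Z = lev ?s ?p {c. k c \<in> Y} (h -` Z)" for Z
    proof -
      have "h -` lev s p Y Z = win ?s (Suc p + of_bool f) {c. k c \<in> split_at p Y Z}"
        unfolding lev_def
      proof (rule Suc.IH)
        show "d = Suc N - (Suc p + of_bool f)" "Suc p + of_bool f \<le> Suc N"
          using Suc.prems p by auto
        show "pr (k c) < Suc p" if "pr c < Suc p + of_bool f" for c
          using that Suc.prems(2)[of c] Suc.prems(3)[of c] by (cases "pr c < ?p") auto
      qed (use Suc.prems(3) in auto)
      also have "\<dots> = lev ?s ?p {c. k c \<in> Y} (h -` Z)"
        unfolding lev_def add_Suc
      proof (rule win_cong)
        fix c assume c: "pr c < Suc ?p"
        show "c \<in> {c. k c \<in> split_at p Y Z} \<longleftrightarrow> c \<in> split_at ?p {c. k c \<in> Y} (h -` Z)"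
          using c Suc.prems(2)[of c] Suc.prems(3)[of c]
          by (cases "pr c < ?p") (auto simp: split_at_def)
      qed (use p in simp)
      finally show ?thesis .
    qed
    then have "h -` fixpt (even p = s) (lev s p Y) = fixpt (even p = s) (lev ?s ?p {c. k c \<in> Y})"
      using assms(1) mono_lev p by (intro vimage_fixpt) auto
    \<comment> \<open>Exchanging the players and lowering the priorities by one cancel, so both
      sides take the same kind of fixed point.\<close>
    moreover have "(even p = s) = (even ?p = ?s)" by (auto simp: of_bool_def)
    ultimately show ?case using p by (simp add: win_fixpt)
  qed
  then show ?thesis by blast
qed

end

section \<open>Strategies that decrease ranks\<close>

text \<open>A postfixed set may be cut down to \<open>I\<close> and a prefixed one filled up outside
  \<open>I\<close>, since the value of either operator on \<open>I\<close> depends only on the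
  argument on \<open>I\<close>.\<close>

lemma fixpt_Int_cong:
  assumes f: "mono f" and g: "mono g"
    and fg: "\<And>Z Z'. Z \<inter> I = Z' \<inter> I \<Longrightarrow> f Z \<inter> I = g Z' \<inter> I"
  shows "fixpt b f \<inter> I = fixpt b g \<inter> I"
proof -
  have *: "fixpt b f \<inter> I \<subseteq> fixpt b g"
    if f: "mono f" and g: "mono g"
      and fg: "\<And>Z Z'. Z \<inter> I = Z' \<inter> I \<Longrightarrow> f Z \<inter> I = g Z' \<inter> I" for f g :: "'a set \<Rightarrow> 'a set"
  proof (cases b)
    case True
    have "g (gfp f \<inter> I) \<inter> I = f (gfp f) \<inter> I" by (rule fg[symmetric]) blast
    then have "gfp f \<inter> I \<subseteq> g (gfp f \<inter> I)" using gfp_fixpoint[OF f] by blast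
    then show ?thesis using True by (simp add: fixpt_def gfp_upperbound)
  next
    case False
    have "f (lfp g \<union> - I) \<inter> I = g (lfp g) \<inter> I" by (rule fg) blast
    then have "f (lfp g \<union> - I) \<subseteq> lfp g \<union> - I" using lfp_fixpoint[OF g] by blast
    then have "lfp f \<subseteq> lfp g \<union> - I" by (rule lfp_lowerbound)
    then show ?thesis using False by (auto simp: fixpt_def)
  qed
  have "g Z \<inter> I = f Z' \<inter> I" if "Z \<inter> I = Z' \<inter> I" for Z Z' using fg that by metis
  then show ?thesis using *[OF f g fg] *[OF g f] by blast
qed

lemma wf_eventually_const:
  assumes "wf R" and "\<And>i. i \<ge> start \<Longrightarrow> f (Suc i) = f i \<or> (f (Suc i), f i) \<in> R"
  shows "\<exists>j\<ge>start. \<forall>i\<ge>j. f i = f j"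
proof -
  obtain z where z: "z \<in> f ` {start..}" "\<And>y. (y, z) \<in> R \<Longrightarrow> y \<notin> f ` {start..}"
    using wfE_min[OF assms(1), of "f start" "f ` {start..}"] by auto
  then obtain j where j: "j \<ge> start" "z = f j" by auto
  have "f i = f j" if "i \<ge> j" for i
    using that
  proof (induction i rule: dec_induct)
    case (step i)
    then have "Suc i \<in> {start..}" using j by simp
    then show ?case using step assms(2)[of i] z(2) j by (metis imageI order_trans)
  qed simp
  then show ?thesis using j by blast
qed

text \<open>A visit to \<open>c\<close> starts a new phase for every larger priority;
  \<open>c\<close> itself then serves as the remembered position.\<close>

definition ctx_upd :: "('a \<Rightarrow> nat) \<Rightarrow> (nat \<Rightarrow> 'a) \<Rightarrow> 'a \<Rightarrow> nat \<Rightarrow> 'a" where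
  "ctx_upd pr \<kappa> c q = (if pr c \<le> q then c else \<kappa> q)"

lemma ctx_upd_zero: "pr c = 0 \<Longrightarrow> ctx_upd pr \<kappa> c = (\<lambda>_. c)"
  by (auto simp: ctx_upd_def)

context parity_game
begin

section \<open>Positions of priority 0 along a play\<close>

inductive next_zero :: "'a \<Rightarrow> 'a \<Rightarrow> bool" where
  next_zero_here: "pr (nx b x) = 0 \<Longrightarrow> next_zero (nx b x) x"
| next_zero_later: "pr (nx b x) \<noteq> 0 \<Longrightarrow> next_zero y (nx b x) \<Longrightarrow> next_zero y x"

lemma acc_nx:
  assumes "x \<in> Wellfounded.acc {(y, x). next_zero y x}"
  shows "nx b x \<in> Wellfounded.acc {(y, x). next_zero y x}"
proof (cases "pr (nx b x) = 0")
  case True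
  then show ?thesis using acc_downward[OF assms, of "nx b x"] next_zero_here by blast
next
  case False
  show ?thesis
  proof (rule accI)
    fix y assume "(y, nx b x) \<in> {(y, x). next_zero y x}"
    then show "y \<in> Wellfounded.acc {(y, x). next_zero y x}"
      using acc_downward[OF assms, of y] next_zero_later[OF False] by blast
  qed
qed

text \<open>Moves within \<open>I\<close> see no priority 0, so the first such position met from
  \<open>I\<close> comes on or after entry into the accessible part, and is accessible
  itself.\<close>

lemma acc_invariant:
  assumes I: "\<And>x b. x \<in> I \<Longrightarrow>
      nx b x \<in> Wellfounded.acc {(y, x). next_zero y x} \<or> pr (nx b x) \<noteq> 0 \<and> nx b x \<in> I"
    and "x \<in> I"
  shows "x \<in> Wellfounded.acc {(y, x). next_zero y x}"
proof (rule accI)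
  have *: "next_zero y z \<Longrightarrow> z \<in> I \<Longrightarrow> y \<in> Wellfounded.acc {(y, x). next_zero y x}" for y z
  proof (induction rule: next_zero.induct)
    case (next_zero_here b x)
    then show ?case using I by blast
  next
    case (next_zero_later b x y)
    then show ?case
      using I[of x b] acc_downward[of "nx b x" "{(y, x). next_zero y x}" y] by blast
  qed
  fix y assume "(y, x) \<in> {(y, x). next_zero y x}"
  then show "y \<in> Wellfounded.acc {(y, x). next_zero y x}" using * assms(2) by blast
qed

lemma finite_zeros_on_path:
  assumes "wf {(y, x). next_zero y x}" and path: "\<And>i. i \<ge> start \<Longrightarrow> \<exists>b. x (Suc i) = nx b (x i)"
  shows "finite {i. pr (x i) = 0}"
proof (rule ccontr)
  assume inf: "infinite {i. pr (x i) = 0}"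
  have "False" if "i \<ge> start" for i
    using that
  proof (induction "x i" arbitrary: i rule: wf_induct_rule[OF assms(1)])
    case (1 i)
    obtain j where j: "j > i" "pr (x j) = 0" using inf unfolding infinite_nat_iff_unbounded by blast
    define m where "m = (LEAST m. m > i \<and> pr (x m) = 0)"
    have m: "m > i" "pr (x m) = 0" unfolding m_def using LeastI[of "\<lambda>m. m > i \<and> pr (x m) = 0" j] j by auto
    have nz: "pr (x l) \<noteq> 0" if "i < l" "l < m" for l
      using that not_less_Least[of l "\<lambda>m. m > i \<and> pr (x m) = 0"] unfolding m_def by auto
    have "next_zero (x m) (x l)" if l: "i \<le> l" "l < m" for l
    proof -
      obtain d where "m = Suc (l + d)" using less_imp_Suc_add[OF l(2)] by blast
      then show ?thesis using l
      proof (induction d arbitrary: l)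
        case 0
        then show ?case using path[of l] \<open>i \<ge> start\<close> m(2) next_zero_here by fastforce
      next
        case (Suc d)
        have "next_zero (x m) (x (Suc l))" using Suc.prems by (intro Suc.IH) auto
        moreover have "pr (x (Suc l)) \<noteq> 0" using Suc.prems by (intro nz) auto
        ultimately show ?case
          using path[of l] \<open>i \<ge> start\<close> Suc.prems next_zero_later by fastforce
      qed
    qed
    then show False using 1(1)[of m] 1(2) m(1) by auto
  qed
  then show False by blast
qed

text \<open>Before it stops, the game does not leave \<open>I\<close>, so only exits one move away
  from \<open>I\<close> matter. This justifies the recursion for \<open>zero_val\<close>.\<close>

lemma win_local:
  assumes I: "\<And>x b. x \<in> I \<Longrightarrow> pr (nx b x) \<noteq> 0 \<Longrightarrow> nx b x \<in> I"
    and "p \<le> Suc N" and "p \<noteq> 0"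
    and "\<And>x b. x \<in> I \<Longrightarrow> pr (nx b x) < p \<Longrightarrow> nx b x \<in> X \<longleftrightarrow> nx b x \<in> Y"
  shows "win s p X \<inter> I = win s p Y \<inter> I"
  using assms(2-)
proof (induction arbitrary: X Y rule: win_induct)
  case top
  have "nx b x \<in> X \<longleftrightarrow> nx b x \<in> Y" if "x \<in> I" for x b
    using top(2) that pr_less less_SucI by blast
  then show ?case by (auto simp: win_top pre_def)
next
  case (level p)
  have "fixpt (even p = s) (lev s p X) \<inter> I = fixpt (even p = s) (lev s p Y) \<inter> I"
  proof (rule fixpt_Int_cong)
    fix Z Z' assume Z: "Z \<inter> I = Z' \<inter> I"
    show "lev s p X Z \<inter> I = lev s p Y Z' \<inter> I"
      unfolding lev_def
    proof (rule level.IH)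
      fix x b assume x: "x \<in> I" "pr (nx b x) < Suc p"
      show "nx b x \<in> split_at p X Z \<longleftrightarrow> nx b x \<in> split_at p Y Z'"
      proof (cases "pr (nx b x) = p")
        case True
        then have "nx b x \<in> I" using I x level.prems(1) by simp
        then show ?thesis using True Z by (auto simp: split_at_def)
      next
        case False
        then show ?thesis using level.prems(2)[of x b] x by (auto simp: split_at_def)
      qed
    qed simp
  qed (use level.hyps mono_lev in auto)
  then show ?case using level.hyps by (simp add: win_fixpt)
qed

end

text \<open>A position of priority 0 exchanges the roles of the players for the rest of the play. Such
  exchanges occur only finitely often on every play, so that the winner is defined by well-founded
  recursion on the next exchange.\<close>

locale swap_game = parity_game +
  assumes wf_next_zero: "wf {(y, x). next_zero y x}"
    and nx_zero: "pr x = 0 \<Longrightarrow> nx b x = nx True x"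
begin

text \<open>Membership in \<open>win\<close> ignores the priority of \<open>x\<close> itself and so
  speaks about the play after the exchange; the negation is the exchange.\<close>

definition zero_val :: "'a \<Rightarrow> bool" where
  "zero_val = wfrec {(y, x). next_zero y x} (\<lambda>f x. x \<notin> win True 1 {d. pr d = 0 \<and> f d})"

definition val :: "'a \<Rightarrow> bool" where
  "val x = (if pr x = 0 then zero_val x else x \<in> win True 1 {d. pr d = 0 \<and> zero_val d})"

lemma zero_val_iff: "zero_val x \<longleftrightarrow> x \<notin> win True 1 {d. pr d = 0 \<and> zero_val d}"
proof -
  let ?R = "{(y, x). next_zero y x}"
  \<comment> \<open>On exits reached from these positions, \<open>cut\<close> does not alter
    \<open>zero_val\<close>.\<close>
  let ?I = "{z. \<forall>y. next_zero y z \<longrightarrow> next_zero y x}"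
  have "win True 1 {d. pr d = 0 \<and> cut zero_val ?R x d} \<inter> ?I = win True 1 {d. pr d = 0 \<and> zero_val d} \<inter> ?I"
    by (rule win_local) (auto intro: next_zero.intros simp: cut_apply)
  then show ?thesis
    using wfrec[OF wf_next_zero, of "\<lambda>f x. x \<notin> win True 1 {d. pr d = 0 \<and> f d}" x]
    unfolding zero_val_def[symmetric] by blast
qed

definition zeros :: "bool \<Rightarrow> 'a set" where
  "zeros s = {c. pr c = 0 \<and> val c = s}"

lemma win_zeros: "win s 1 (zeros s) = (if s then id else uminus) (win True 1 {d. pr d = 0 \<and> zero_val d})"
proof -
  have "win False 1 (zeros False) = win False 1 (- {d. pr d = 0 \<and> zero_val d})"
    by (rule win_cong) (auto simp: zeros_def val_def)
  moreover have "win True 1 (zeros True) = win True 1 {d. pr d = 0 \<and> zero_val d}"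
    by (rule win_cong) (auto simp: zeros_def val_def)
  ultimately show ?thesis using win_Compl[of 1 True] by (cases s) simp_all
qed

lemma val_iff_win: "pr x \<noteq> 0 \<Longrightarrow> val x = s \<longleftrightarrow> x \<in> win s 1 (zeros s)"
  unfolding win_zeros by (auto simp: val_def)

lemma zero_iff_win:
  assumes "pr x = 0"
  shows "val (nx b x) = s \<longleftrightarrow> x \<in> win s 1 (zeros s)"
proof -
  have "x \<in> win s 1 (zeros s) \<longleftrightarrow> (if pr (nx b x) < 1 then nx b x \<in> zeros s else nx b x \<in> win s 1 (zeros s))"
    using nx_zero[OF assms, of b] nx_zero[OF assms, of False] by (subst win_pre) (auto simp: pre_def all_bool_eq ex_bool_eq)
  then show ?thesis using val_iff_win[of "nx b x" s] by (auto simp: zeros_def)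
qed

lemma val_zero: "pr x = 0 \<Longrightarrow> val (nx b x) \<longleftrightarrow> \<not> val x"
  using zero_iff_win[of x b True] zero_val_iff[of x] win_zeros[of True] by (simp add: val_def)

lemma val_iff_win_at:
  assumes "pr x \<noteq> 0" "1 \<le> q" "q \<le> Suc N"
  shows "val x = s \<longleftrightarrow> x \<in> win s q {y. pr y < q \<and> val y = s}"
proof -
  have "win s 1 (zeros s) = win s q {c. if pr c < 1 then c \<in> zeros s else c \<in> win s 1 (zeros s)}"
    using assms by (intro win_unfold) auto
  also have "\<dots> = win s q {y. pr y < q \<and> val y = s}"
    using assms(3) val_iff_win by (intro win_cong) (auto simp: zeros_def)
  finally show ?thesis using val_iff_win[OF assms(1)] by simp
qed

text \<open>A context \<open>\<kappa>\<close> remembers, for each priority \<open>q\<close> that is bad for \<open>s\<close>, the position at which the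
  current phase without priorities below \<open>q\<close> last saw \<open>q\<close>. A position of priority \<open>q\<close> is good if it is
  winning relative to the lower levels and, for bad \<open>q\<close>, has smaller rank than \<open>\<kappa> q\<close>. Moving to good
  positions forever is winning, since the ranks decrease.\<close>

primrec good :: "bool \<Rightarrow> (nat \<Rightarrow> 'a) \<Rightarrow> nat \<Rightarrow> 'a set" where
  "good s \<kappa> 0 = zeros s"
| "good s \<kappa> (Suc p) = good s \<kappa> p \<union> {c. pr c = Suc p \<and>
     (if even (Suc p) = s then c \<in> win s (Suc p) (good s \<kappa> p)
      else c \<in> below (lev s (Suc p) (good s \<kappa> p)) (\<kappa> (Suc p)))}"

lemma good_pr: "c \<in> good s \<kappa> p \<Longrightarrow> pr c \<le> p"
  by (induction p) (auto simp: zeros_def)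

lemma good_cong: "(\<And>q. q \<le> p \<Longrightarrow> \<kappa> q = \<kappa>' q) \<Longrightarrow> good s \<kappa> p = good s \<kappa>' p"
  by (induction p) auto

lemma good_restrict: "p \<le> q \<Longrightarrow> c \<in> good s \<kappa> p \<longleftrightarrow> c \<in> good s \<kappa> q \<and> pr c \<le> p"
proof (induction q rule: dec_induct)
  case base
  then show ?case using good_pr by blast
qed auto

lemma good_Suc_split:
  "good s \<kappa> (Suc p) = split_at (Suc p) (good s \<kappa> p)
     (if even (Suc p) = s then win s (Suc p) (good s \<kappa> p)
      else below (lev s (Suc p) (good s \<kappa> p)) (\<kappa> (Suc p)))"
proof (rule set_eqI)
  fix c
  show "c \<in> good s \<kappa> (Suc p) \<longleftrightarrow> c \<in> split_at (Suc p) (good s \<kappa> p)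
     (if even (Suc p) = s then win s (Suc p) (good s \<kappa> p)
      else below (lev s (Suc p) (good s \<kappa> p)) (\<kappa> (Suc p)))"
    using good_pr[of c s \<kappa> p] by (cases "pr c = Suc p") (auto simp: split_at_def)
qed

lemma win_good_Suc:
  "win s (Suc (Suc p)) (good s \<kappa> (Suc p)) = lev s (Suc p) (good s \<kappa> p)
     (if even (Suc p) = s then win s (Suc p) (good s \<kappa> p)
      else below (lev s (Suc p) (good s \<kappa> p)) (\<kappa> (Suc p)))"
  unfolding lev_def good_Suc_split ..

text \<open>The second clause gives the remembered positions a rank: they lie in the least fixed
  points of the bad priorities.\<close>

definition ctx_ok :: "bool \<Rightarrow> (nat \<Rightarrow> 'a) \<Rightarrow> bool" where
  "ctx_ok s \<kappa> \<longleftrightarrow> (\<forall>q. pr (\<kappa> q) \<le> q) \<and>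
     (\<forall>p<N. even (Suc p) \<noteq> s \<longrightarrow> \<kappa> (Suc p) \<in> win s (Suc p) (good s \<kappa> p))"

definition secure :: "bool \<Rightarrow> 'a \<Rightarrow> (nat \<Rightarrow> 'a) \<Rightarrow> bool" where
  "secure s x \<kappa> \<longleftrightarrow> x \<in> pre s (good s \<kappa> N) \<and> ctx_ok s \<kappa>"

lemma lfp_lev: "p \<le> N \<Longrightarrow> even p \<noteq> s \<Longrightarrow> win s p X = lfp (lev s p X)"
  by (simp add: win_fixpt fixpt_def)

text \<open>The levels above \<open>m\<close> are climbed one at a time. At a good priority the
  fixed point unfolds; at a bad one \<open>x\<close> lies in one step over the elements of rank
  below its own, and \<open>x\<close> is what the context remembers.\<close>

lemma secure_of_win:
  assumes "m \<le> N" "x \<in> win s (Suc m) (good s \<kappa> m)"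
    and x: "\<And>q. q > m \<Longrightarrow> \<kappa> q = x"
    and pr: "\<And>q. pr (\<kappa> q) \<le> q"
    and lower: "\<And>p. p < m \<Longrightarrow> even (Suc p) \<noteq> s \<Longrightarrow> \<kappa> (Suc p) \<in> win s (Suc p) (good s \<kappa> p)"
  shows "secure s x \<kappa>"
proof -
  have win: "x \<in> win s (Suc q) (good s \<kappa> q)" if "m \<le> q" "q \<le> N" for q
    using that
  proof (induction q rule: dec_induct)
    case (step q)
    let ?f = "lev s (Suc q) (good s \<kappa> q)"
    have IH: "x \<in> win s (Suc q) (good s \<kappa> q)" and q: "Suc q \<le> N" using step by auto
    show ?case
    proof (cases "even (Suc q) = s")
      case True
      then show ?thesis unfolding win_good_Suc using IH win_lev[OF q] by simp
    next
      case False
      then have "x \<in> lfp ?f" using IH lfp_lev[OF q] by simp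
      then have "x \<in> ?f (below ?f x)" by (rule lfp_in_step_below[OF mono_lev[OF q]])
      then show ?thesis unfolding win_good_Suc using False x[of "Suc q"] step.hyps by simp
    qed
  qed (use assms(2) in simp)
  have "ctx_ok s \<kappa>" unfolding ctx_ok_def
  proof (intro conjI allI impI)
    fix p assume "p < N" "even (Suc p) \<noteq> s"
    then show "\<kappa> (Suc p) \<in> win s (Suc p) (good s \<kappa> p)"
      using lower[of p] win[of p] x[of "Suc p"] by (cases "p < m") auto
  qed (rule pr)
  then show ?thesis using win[of N] assms(1) by (simp add: secure_def win_top)
qed

lemma good_step:
  assumes \<kappa>: "ctx_ok s \<kappa>" and c: "c \<in> good s \<kappa> N" and "pr c \<noteq> 0"
  shows "secure s c (ctx_upd pr \<kappa> c)"
proof -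
  obtain p where p: "pr c = Suc p" using assms(3) by (cases "pr c") auto
  have pN: "Suc p < N" using pr_less[of c] p by simp
  have cong: "good s (ctx_upd pr \<kappa> c) q = good s \<kappa> q" if "q \<le> p" for q
    using that p by (intro good_cong) (auto simp: ctx_upd_def)
  have "c \<in> good s \<kappa> (Suc p)" using good_restrict[of "Suc p" N c] c p pN by simp
  then have "c \<in> win s (Suc p) (good s \<kappa> p)"
    using p good_pr[of c s \<kappa> p] pN below_subset_lfp[OF mono_lev[of "Suc p" s "good s \<kappa> p"], of "\<kappa> (Suc p)"]
    by (auto simp: lfp_lev split: if_splits)
  then have "c \<in> win s (Suc p) (good s (ctx_upd pr \<kappa> c) p)" by (simp add: cong)
  then show ?thesis
    using pN p \<kappa> cong by (intro secure_of_win[of p]) (auto simp: ctx_upd_def ctx_ok_def)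
qed

lemma good_fresh:
  assumes "pr x = 0" "val (nx b x) = s"
  shows "nx b x \<in> good s (\<lambda>_. x) N" "ctx_ok s (\<lambda>_. x)"
proof -
  have "secure s x (\<lambda>_. x)"
    using assms zero_iff_win[of x b s] by (intro secure_of_win[of 0]) auto
  then show "nx b x \<in> good s (\<lambda>_. x) N" "ctx_ok s (\<lambda>_. x)"
    using nx_zero[OF assms(1), of b] nx_zero[OF assms(1), of False]
    by (auto simp: secure_def pre_def all_bool_eq ex_bool_eq split: if_splits)
qed

lemma good_val: "c \<in> good s \<kappa> N \<Longrightarrow> pr c = 0 \<Longrightarrow> val c = s"
  using good_restrict[of 0 N c s \<kappa>] by (simp add: zeros_def)

text \<open>If \<open>p\<close> were bad, the context below \<open>p\<close> would be frozen, hence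
  also the operator defining the ranks, and each visit to \<open>p\<close> would decrease a rank.
  Entries from \<open>m\<close> on may be altered between steps, so that several moves of high
  priority can count as one step.\<close>

lemma path_parity:
  assumes step: "\<And>i. i \<ge> start \<Longrightarrow> \<exists>\<kappa>'. (\<forall>q<m. \<kappa>' q = \<kappa> i q) \<and> x (Suc i) \<in> good s \<kappa>' N \<and> \<kappa> (Suc i) = ctx_upd pr \<kappa>' (x (Suc i))"
    and p: "p \<noteq> 0" "p < m" "\<And>i. i \<ge> start \<Longrightarrow> p \<le> pr (x (Suc i))" "infinite {i. pr (x i) = p}"
  shows "even p = s"
proof (rule ccontr)
  assume odd: "even p \<noteq> s"
  obtain p' where p': "p = Suc p'" using p(1) by (cases p) auto
  let ?f = "lev s p (good s (\<kappa> start) p')"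
  have const: "\<kappa> i q = \<kappa> start q" if "i \<ge> start" "q < p" for i q
    using that(1)
  proof (induction i rule: dec_induct)
    case (step i)
    then show ?case using assms(1)[of i] p(3)[of i] that(2) p(2) by (auto simp: ctx_upd_def)
  qed simp
  have desc: "if pr (x (Suc i)) = p then \<kappa> (Suc i) p \<in> below ?f (\<kappa> i p) else \<kappa> (Suc i) p = \<kappa> i p"
    if i: "i \<ge> start" for i
  proof -
    obtain \<kappa>' where \<kappa>': "\<forall>q<m. \<kappa>' q = \<kappa> i q" "x (Suc i) \<in> good s \<kappa>' N" "\<kappa> (Suc i) = ctx_upd pr \<kappa>' (x (Suc i))"
      using step[OF i] by blast
    have "good s \<kappa>' p' = good s (\<kappa> start) p'"
      using \<kappa>'(1) const[OF i] p(2) p' by (intro good_cong) auto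
    moreover have "x (Suc i) \<in> good s \<kappa>' p" if "pr (x (Suc i)) = p"
      using \<kappa>'(2) that good_restrict[of p N "x (Suc i)" s \<kappa>'] pr_less[of "x (Suc i)"] by simp
    moreover have "x (Suc i) \<notin> good s \<kappa>' p'" if "pr (x (Suc i)) = p"
      using good_pr[of "x (Suc i)" s \<kappa>' p'] that p' by auto
    moreover have "\<kappa>' p = \<kappa> i p" using \<kappa>'(1) p(2) by blast
    ultimately show ?thesis
      using \<kappa>'(3) p(3)[OF i] odd p' by (auto simp: ctx_upd_def split: if_splits)
  qed
  have "p \<le> N" using p(4) pr_less by (metis (mono_tags) finite.emptyI empty_Collect_eq less_imp_le)
  then have "wf {(x, y). x \<in> below ?f y}" by (rule wf_below[OF mono_lev])
  then obtain j where j: "j \<ge> start" "\<And>i. i \<ge> j \<Longrightarrow> \<kappa> i p = \<kappa> j p"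
    using wf_eventually_const[of _ start "\<lambda>i. \<kappa> i p"] desc by (metis (no_types, lifting) case_prodI mem_Collect_eq)
  obtain i where "i > j" "pr (x i) = p"
    using p(4) unfolding infinite_nat_iff_unbounded by auto
  then obtain i' where "i' \<ge> j" "pr (x (Suc i')) = p" using less_Suc_eq_le by (cases i) auto
  then have "\<kappa> (Suc i') p \<in> below ?f (\<kappa> i' p)" using desc[of i'] j(1) by auto
  then show False using j(2)[of i'] j(2)[of "Suc i'"] \<open>i' \<ge> j\<close> by (simp add: not_below_self)
qed

end

section \<open>The universal game\<close>

text \<open>Positions of one universal game. \<open>Root\<close>, \<open>EveCh\<close> and \<open>AdamCh\<close> describe the acceptance game of the
  given alternating automaton with the roles exchanged, its transitions being resolved by a sequence
  of binary choices; instead of a node of the input tree they carry the position (a term with a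
  context for either player) from which the subtree at that node is unravelled. Starting the
  automaton at \<open>Root\<close> on the tree unravelled from \<open>Root\<close> itself gives the diagonal tree.
  \<open>Play s q \<kappa> c\<close> and \<open>RaceE s q \<kappa> e c\<close> are the games that decide whether \<open>c\<close>, of priority \<open>q\<close>, is good
  for \<open>s\<close> in the context \<open>\<kappa>\<close>. In a race \<open>s\<close> claims that \<open>c\<close> has smaller rank than \<open>e\<close>: the play
  proceeds on the board \<open>e\<close> with exchanged roles until \<open>q\<close> is seen, then (\<open>RaceC\<close>) on the board \<open>c\<close>
  until \<open>q\<close> is seen, and so on.\<close>

datatype trm =
    Root
  | EveCh trm "bool \<Rightarrow> nat \<Rightarrow> trm" nat "(nat \<times> nat) list list"
  | AdamCh trm "bool \<Rightarrow> nat \<Rightarrow> trm" "(nat \<times> nat) list"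
  | Sw trm
  | Play bool nat "nat \<Rightarrow> trm" trm
  | RaceE bool nat "nat \<Rightarrow> trm" trm trm
  | RaceC bool nat "nat \<Rightarrow> trm" trm trm

locale term_game =
  fixes n :: nat and en :: "nat \<Rightarrow> nat \<Rightarrow> (nat \<times> nat) list list" and om :: "nat \<Rightarrow> nat" and q0 :: nat
  assumes n_ge_2: "2 \<le> n"
begin

text \<open>Clamping only matters for terms that never occur; it makes the bounds on priorities hold for
  all terms.\<close>

definition clamp :: "nat \<Rightarrow> nat" where
  "clamp q = max 1 (min n q)"

primrec own :: "trm \<Rightarrow> bool" where
  "own Root = True"
| "own (EveCh y \<kappa> p D) = False"
| "own (AdamCh y \<kappa> S) = True"
| "own (Sw t) = True"
| "own (Play s q \<kappa> c) = own c"
| "own (RaceE s q \<kappa> e c) = (\<not> own e)"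
| "own (RaceC s q \<kappa> c e) = own c"

text \<open>An empty disjunction becomes a sink won by \<open>True\<close>, who acts as Adam, an
  empty conjunction a sink won by \<open>False\<close>, who acts as Eve. Other intermediate choices
  get the neutral priority \<open>n\<close>.\<close>

primrec pr :: "trm \<Rightarrow> nat" where
  "pr Root = 1"
| "pr (EveCh y \<kappa> p D) = (if D = [] then 2 else clamp p)"
| "pr (AdamCh y \<kappa> S) = (if S = [] then 1 else n)"
| "pr (Sw t) = 0"
| "pr (Play s q \<kappa> c) = max (clamp q) (pr c)"
| "pr (RaceE s q \<kappa> e c) = max (clamp q) (pr e - 1)"
| "pr (RaceC s q \<kappa> c e) = max (clamp q) (pr c)"

lemma clamp_bounds: "1 \<le> clamp q" "clamp q \<le> n"
  using n_ge_2 by (auto simp: clamp_def)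

lemma clamp_eq: "1 \<le> q \<Longrightarrow> q \<le> n \<Longrightarrow> clamp q = q"
  by (auto simp: clamp_def)

lemma pr_le: "pr t \<le> n"
  by (induction t) (use n_ge_2 clamp_bounds in \<open>auto simp: le_diff_conv trans_le_add1\<close>)

lemma pr_eq_0_iff: "pr t = 0 \<longleftrightarrow> (\<exists>t'. t = Sw t')"
  using n_ge_2 by (cases t) (auto simp: clamp_def max_nat.eq_neutr_iff)

definition lab :: "trm \<Rightarrow> nat" where
  "lab t = (if pr t = 0 then 0 else 2 * pr t + of_bool (own t))"

text \<open>At priority 0, being good is a matter of value alone, so \<open>c\<close> is its own
  test.\<close>

definition test :: "bool \<Rightarrow> (nat \<Rightarrow> trm) \<Rightarrow> trm \<Rightarrow> trm" where
  "test s \<kappa> c = (if pr c = 0 then c else if even (pr c) = s then Play s (pr c) \<kappa> c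
     else RaceE s (pr c) \<kappa> (\<kappa> (pr c)) c)"

text \<open>The start at \<open>y\<close> is modelled as the move from \<open>Sw y\<close>, after
  which \<open>good_fresh\<close> provides valid contexts.\<close>

definition fresh :: "trm \<Rightarrow> bool \<Rightarrow> nat \<Rightarrow> trm" where
  "fresh y = (\<lambda>_. ctx_upd pr (\<lambda>_. Sw y) y)"

text \<open>The successors are arguments because \<open>kid\<close> occurs inside the primitive
  recursion for \<open>nx\<close>. Testing \<open>y0\<close> suffices: if the owner is secure and
  \<open>y0\<close> is not good, then \<open>y1\<close> is.\<close>

definition kid :: "nat \<Rightarrow> bool \<Rightarrow> (bool \<Rightarrow> nat \<Rightarrow> trm) \<Rightarrow> trm \<Rightarrow> trm \<Rightarrow> trm \<times> (bool \<Rightarrow> nat \<Rightarrow> trm)" where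
  "kid d a \<kappa> y0 y1 = (
     if d = 0 then (y0, \<lambda>s. ctx_upd pr (\<kappa> s) y0)
     else if d = 1 then (test a (\<kappa> a) y0, fresh (test a (\<kappa> a) y0))
     else (y1, \<lambda>s. ctx_upd pr (\<kappa> s) y1))"

definition enter :: "trm \<times> (bool \<Rightarrow> nat \<Rightarrow> trm) \<Rightarrow> nat \<Rightarrow> trm" where
  "enter z q = EveCh (fst z) (snd z) (Suc (om q)) (en q (lab (fst z)))"

definition play_to :: "bool \<Rightarrow> nat \<Rightarrow> (nat \<Rightarrow> trm) \<Rightarrow> trm \<Rightarrow> trm" where
  "play_to s q \<kappa> c = (if q \<le> pr c then Play s q \<kappa> c else test s \<kappa> c)"

text \<open>On the exchanged board \<open>s\<close> has to win the exit iff it is not good, so the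
  test is entered through \<open>Sw\<close>.\<close>

definition raceE_to :: "bool \<Rightarrow> nat \<Rightarrow> (nat \<Rightarrow> trm) \<Rightarrow> trm \<Rightarrow> trm \<Rightarrow> trm" where
  "raceE_to s q \<kappa> c e = (if q < pr e then RaceE s q \<kappa> e c
     else if pr e = q then RaceC s q \<kappa> c e else Sw (test s \<kappa> e))"

definition raceC_to :: "bool \<Rightarrow> nat \<Rightarrow> (nat \<Rightarrow> trm) \<Rightarrow> trm \<Rightarrow> trm \<Rightarrow> trm" where
  "raceC_to s q \<kappa> e c = (if q < pr c then RaceC s q \<kappa> c e
     else if pr c = q then RaceE s q \<kappa> e c else test s \<kappa> c)"

primrec nx :: "bool \<Rightarrow> trm \<Rightarrow> trm" where
  "nx b Root = enter (Root, fresh Root) q0"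
| "nx b (EveCh y \<kappa> p D) = (case D of [] \<Rightarrow> EveCh y \<kappa> p []
     | S # D' \<Rightarrow> if b then AdamCh y \<kappa> S else EveCh y \<kappa> n D')"
| "nx b (AdamCh y \<kappa> S) = (case S of [] \<Rightarrow> AdamCh y \<kappa> []
     | dq # S' \<Rightarrow> if b then enter (kid (fst dq) (own y) \<kappa> (nx True y) (nx False y)) (snd dq)
        else AdamCh y \<kappa> S')"
| "nx b (Sw t) = t"
| "nx b (Play s q \<kappa> c) = play_to s q \<kappa> (nx b c)"
| "nx b (RaceE s q \<kappa> e c) = raceE_to s q \<kappa> c (nx b e)"
| "nx b (RaceC s q \<kappa> c e) = raceC_to s q \<kappa> e (nx b c)"

sublocale parity_game own pr nx "Suc n"
  by unfold_locales (simp add: pr_le le_imp_less_Suc)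

abbreviation fin :: "trm \<Rightarrow> bool" where
  "fin x \<equiv> x \<in> Wellfounded.acc {(y, x). next_zero y x}"

lemma fin_Sw: "fin t \<Longrightarrow> fin (Sw t)"
proof (rule acc_invariant[of "{Sw t}"])
  fix x b assume "fin t" "x \<in> {Sw t}"
  then show "fin (nx b x) \<or> pr (nx b x) \<noteq> 0 \<and> nx b x \<in> {Sw t}" by simp
qed simp

text \<open>A comparison with mark \<open>q\<close> exits only into tests of priority below
  \<open>q\<close>, whose remembered positions are accessible by assumption.\<close>

lemma fin_race:
  assumes \<kappa>: "\<And>q. fin (\<kappa> q)"
  shows "fin c \<Longrightarrow> fin e \<Longrightarrow> fin (Play s q \<kappa> c) \<and> fin (RaceE s q \<kappa> e c) \<and> fin (RaceC s q \<kappa> c e)"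
proof (induction q arbitrary: c e rule: less_induct)
  case (less q)
  have test: "fin (test s \<kappa> c)" if "pr c < q" "fin c" for c
    using less.IH[OF that(1)] that(2) \<kappa> by (auto simp: test_def)
  have clamp: "clamp q \<noteq> 0" using clamp_bounds(1)[of q] by simp
  let ?P = "{Play s q \<kappa> c | c. fin c}"
  have P: "fin x" if "x \<in> ?P" for x
  proof (rule acc_invariant[OF _ that])
    fix x b assume "x \<in> ?P"
    then obtain c where "x = Play s q \<kappa> c" "fin (nx b c)" using acc_nx by blast
    then show "fin (nx b x) \<or> pr (nx b x) \<noteq> 0 \<and> nx b x \<in> ?P"
      using test[of "nx b c"] clamp by (cases "q \<le> pr (nx b c)") (simp_all add: play_to_def)
  qed
  let ?R = "{RaceE s q \<kappa> e c | e c. fin c \<and> fin e} \<union> {RaceC s q \<kappa> c e | e c. fin c \<and> fin e}"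
  have R: "fin x" if "x \<in> ?R" for x
  proof (rule acc_invariant[OF _ that])
    fix x b assume "x \<in> ?R"
    then consider e c where "x = RaceE s q \<kappa> e c" "fin c" "fin (nx b e)"
      | e c where "x = RaceC s q \<kappa> c e" "fin e" "fin (nx b c)"
      using acc_nx by blast
    then show "fin (nx b x) \<or> pr (nx b x) \<noteq> 0 \<and> nx b x \<in> ?R"
    proof cases
      case (1 e c)
      then show ?thesis
        using test[of "nx b e"] clamp fin_Sw[of "test s \<kappa> (nx b e)"]
        by (cases "pr (nx b e)" q rule: linorder_cases) (simp_all add: raceE_to_def)
    next
      case (2 e c)
      then show ?thesis
        using test[of "nx b c"] clamp
        by (cases "pr (nx b c)" q rule: linorder_cases) (simp_all add: raceC_to_def)
    qed
  qed
  show ?case by (intro conjI P R) (simp_all add: less.prems)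
qed

lemma fin_choice: "fin Root" "fin (EveCh y \<kappa> p D)" "fin (AdamCh y \<kappa> S)"
proof -
  let ?I = "{x. x = Root \<or> (\<exists>y \<kappa> p D. x = EveCh y \<kappa> p D) \<or> (\<exists>y \<kappa> S. x = AdamCh y \<kappa> S)}"
  have *: "fin x" if "x \<in> ?I" for x
  proof (rule acc_invariant[OF _ that])
    fix x b assume "x \<in> ?I"
    then have "nx b x \<in> ?I" by (auto simp: enter_def split: list.splits)
    moreover from this have "pr (nx b x) \<noteq> 0" by (auto simp: pr_eq_0_iff)
    ultimately show "fin (nx b x) \<or> pr (nx b x) \<noteq> 0 \<and> nx b x \<in> ?I" by blast
  qed
  show "fin Root" "fin (EveCh y \<kappa> p D)" "fin (AdamCh y \<kappa> S)" by (rule *; simp)+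
qed

lemma fin_all: "fin t"
proof (induction t)
  case (Play s q \<kappa> c)
  then show ?case using fin_race[of \<kappa> c c] by (metis rangeI)
next
  case (RaceE s q \<kappa> e c)
  then show ?case using fin_race[of \<kappa> c e] by (metis rangeI)
next
  case (RaceC s q \<kappa> c e)
  then show ?case using fin_race[of \<kappa> c e] by (metis rangeI)
qed (rule fin_Sw fin_choice; assumption?)+

sublocale swap_game own pr nx "Suc n"
  by unfold_locales (use fin_all in \<open>auto simp: wf_iff_acc pr_eq_0_iff\<close>)

section \<open>Correctness of the tests\<close>

lemma test_pr: "pr (\<kappa> (pr c)) \<le> pr c \<Longrightarrow> pr (test s \<kappa> c) = pr c"
  using pr_le[of c] by (auto simp: test_def clamp_eq)

text \<open>A test of priority \<open>q\<close> ends in tests of smaller priority, whence the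
  induction. For bad \<open>q\<close> the race is solved from both sides, by induction on ranks for
  \<open>s\<close> and by a postfixed set for the opponent.\<close>

lemma test_val:
  assumes \<kappa>: "ctx_ok s \<kappa>"
  shows "val (test s \<kappa> c) = s \<longleftrightarrow> c \<in> good s \<kappa> (Suc n)"
proof (induction "pr c" arbitrary: c rule: less_induct)
  case less
  have pr_\<kappa>: "pr (\<kappa> q) \<le> q" for q using \<kappa> by (simp add: ctx_ok_def)
  show ?case
  proof (cases "pr c")
    case 0
    then show ?thesis using good_restrict[of 0 "Suc n" c s \<kappa>] by (auto simp: test_def zeros_def)
  next
    case (Suc p)
    define q where "q = Suc p"
    define G where "G = good s \<kappa> p"
    define Y where "Y = {y. pr y < q \<and> val y = s}"
    have q: "1 \<le> q" "q \<le> n" "pr c = q" and clamp: "clamp q = q"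
      using Suc pr_le[of c] by (auto simp: q_def clamp_eq)
    have exit: "test s \<kappa> c' \<in> Y \<longleftrightarrow> c' \<in> G" "Sw (test s \<kappa> c') \<in> Y \<longleftrightarrow> c' \<notin> G"
      "pr (test s \<kappa> c') < q" if "pr c' < q" for c'
    proof -
      have "val (test s \<kappa> c') = s \<longleftrightarrow> c' \<in> G"
        using less[of c'] that Suc good_restrict[of p "Suc n" c' s \<kappa>] pr_le[of c] by (auto simp: q_def G_def)
      moreover have "val (Sw (test s \<kappa> c')) \<longleftrightarrow> \<not> val (test s \<kappa> c')"
        using val_zero[of "Sw (test s \<kappa> c')"] by simp
      ultimately show "test s \<kappa> c' \<in> Y \<longleftrightarrow> c' \<in> G" "Sw (test s \<kappa> c') \<in> Y \<longleftrightarrow> c' \<notin> G"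
        "pr (test s \<kappa> c') < q"
        using that q test_pr[of \<kappa>, OF pr_\<kappa>] by (auto simp: Y_def)
    qed
    have val_test: "val (test s \<kappa> c) = s \<longleftrightarrow> test s \<kappa> c \<in> win s q Y"
      unfolding Y_def using q test_pr[of \<kappa>, OF pr_\<kappa>] by (intro val_iff_win_at) auto
    have good_c: "c \<in> good s \<kappa> (Suc n) \<longleftrightarrow>
        (if even q = s then c \<in> win s q G else c \<in> below (lev s q G) (\<kappa> q))"
      using good_restrict[of q "Suc n" c s \<kappa>] q good_pr[of c s \<kappa> p] by (auto simp: q_def G_def)
    show ?thesis
    proof (cases "even q = s")
      case True
      have "Play s q \<kappa> c \<in> win s q Y \<longleftrightarrow> c \<in> win (s \<noteq> False) (q + of_bool False) {c. play_to s q \<kappa> c \<in> Y}"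
        by (rule win_transfer)
          (use q exit clamp in \<open>auto simp: play_to_def inj_def\<close>)
      also have "win (s \<noteq> False) (q + of_bool False) {c. play_to s q \<kappa> c \<in> Y} = win s q G"
        using q exit by (simp, intro win_cong) (auto simp: play_to_def)
      finally show ?thesis using True val_test good_c q by (simp add: test_def)
    next
      case False
      define f where "f = lev s q G"
      have f: "mono f" unfolding f_def using q by (intro mono_lev) simp
      have f_eq: "f Z = win s (Suc q) (split_at q G Z)" for Z by (simp add: f_def lev_def)
      have lfp_f: "lfp f = win s q G" unfolding f_def using q False by (simp add: lfp_lev)
      have Z_eq: "win s q Y = win s (Suc q) (split_at q Y (win s q Y))"
        using win_lev[of q s Y] q by (simp add: lev_def)
      have RC: "RaceC s q \<kappa> c e \<in> win s' (Suc q) W \<longleftrightarrow> c \<in> win s' (Suc q) {c. raceC_to s q \<kappa> e c \<in> W}"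
        if "pr e \<le> q" for c e s' W
      proof -
        have "RaceC s q \<kappa> c e \<in> win s' (Suc q) W \<longleftrightarrow>
            c \<in> win (s' \<noteq> False) (Suc q + of_bool False) {c. raceC_to s q \<kappa> e c \<in> W}"
        proof (rule win_transfer)
          show "pr (raceC_to s q \<kappa> e c) < Suc q" if "pr c < Suc q + of_bool False" for c
            using that \<open>pr e \<le> q\<close> exit(3)[of c] clamp by (cases "pr c = q") (auto simp: raceC_to_def)
          show "raceC_to s q \<kappa> e c = RaceC s q \<kappa> c e \<and> pr (RaceC s q \<kappa> c e) + of_bool False = pr c"
            if "Suc q + of_bool False \<le> pr c" for c
            using that clamp by (simp add: raceC_to_def)
        qed (use q in \<open>simp_all add: inj_def\<close>)
        then show ?thesis by simp
      qed
      \<comment> \<open>On this board priority \<open>Suc q\<close> becomes the mark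
        \<open>q\<close> of the race, so the play is interrupted already there.\<close>
      have RE: "RaceE s q \<kappa> e c \<in> win s' (Suc q) W \<longleftrightarrow> e \<in> win (\<not> s') (Suc (Suc q)) {e. raceE_to s q \<kappa> c e \<in> W}"
        if "pr c = q" for c e s' W
      proof -
        have "RaceE s q \<kappa> e c \<in> win s' (Suc q) W \<longleftrightarrow>
            e \<in> win (s' \<noteq> True) (Suc q + of_bool True) {e. raceE_to s q \<kappa> c e \<in> W}"
        proof (rule win_transfer)
          show "pr (raceE_to s q \<kappa> c e) < Suc q" if "pr e < Suc q + of_bool True" for e
            using that \<open>pr c = q\<close> clamp by (auto simp: raceE_to_def)
          show "raceE_to s q \<kappa> c e = RaceE s q \<kappa> e c \<and> pr (RaceE s q \<kappa> e c) + of_bool True = pr e"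
            if "Suc q + of_bool True \<le> pr e" for e
            using that clamp by (simp add: raceE_to_def)
        qed (use q in \<open>simp_all add: inj_def\<close>)
        then show ?thesis by simp
      qed
      \<comment> \<open>Invariant of \<open>s\<close>: \<open>c\<close> has smaller rank than
        \<open>e\<close> when the \<open>e\<close> board moves, and at most that of \<open>e\<close>
        when the \<open>c\<close> board moves. The rank of \<open>c\<close> decreases at each return
        to the \<open>e\<close> board.\<close>
      have winning: "\<forall>e. e \<notin> f (below f c) \<longrightarrow> RaceE s q \<kappa> e c \<in> win s q Y"
        if "c \<in> lfp f" "pr c = q" for c
        using that
      proof (induction c rule: wf_induct_rule[OF wf_below[OF f]])
        case (1 c)
        have C: "RaceC s q \<kappa> c e \<in> win s q Y" if e: "pr e = q" "c \<in> f (below f e)" for e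
        proof -
          have "c \<in> win s (Suc q) (split_at q G (below f c))"
            using lfp_in_step_below[OF f 1(2)] by (simp add: f_eq[of "below f c", symmetric])
          moreover have "win s (Suc q) (split_at q G (below f c))
              \<subseteq> win s (Suc q) {c. raceC_to s q \<kappa> e c \<in> split_at q Y (win s q Y)}"
          proof (rule win_mono)
            fix c' assume c': "pr c' < Suc q" "c' \<in> split_at q G (below f c)"
            show "c' \<in> {c. raceC_to s q \<kappa> e c \<in> split_at q Y (win s q Y)}"
            proof (cases "pr c' = q")
              case True
              then have b: "c' \<in> below f c" using c' by (simp add: split_at_def)
              then have "RaceE s q \<kappa> e c' \<in> win s q Y"
                using 1(1)[of c'] below_subset_lfp[OF f, of c] below_step_trans[OF f b e(2)] True by blast
              then show ?thesis using True clamp e by (simp add: raceC_to_def split_at_def)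
            next
              case F: False
              then show ?thesis using c' exit[of c'] by (simp add: raceC_to_def split_at_def)
            qed
          qed (use q in simp)
          ultimately show ?thesis using e by (subst Z_eq, subst RC) auto
        qed
        show ?case
        proof (intro allI impI)
          fix e assume e: "e \<notin> f (below f c)"
          define X where "X = - split_at q G (below f c)"
          have "e \<in> win (\<not> s) (Suc q) X"
            using e q by (simp add: X_def f_eq win_Compl)
          \<comment> \<open>\<open>Suc q\<close> is bad for the player whose part \<open>s\<close>
            takes on this board; this inner least fixed point bounds the visits to it before the
            board is left.\<close>
          then have "e \<in> lfp (lev (\<not> s) (Suc q) X)" using False q by (simp add: lfp_lev)
          also have "\<dots> \<subseteq> {e. RaceE s q \<kappa> e c \<in> win s q Y}" (is "_ \<subseteq> ?B")
          proof (rule lfp_lowerbound)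
            have "win (\<not> s) (Suc (Suc q)) (split_at (Suc q) X ?B) \<subseteq>
                win (\<not> s) (Suc (Suc q)) {e. raceE_to s q \<kappa> c e \<in> split_at q Y (win s q Y)}"
            proof (rule win_mono)
              fix e' assume e': "pr e' < Suc (Suc q)" "e' \<in> split_at (Suc q) X ?B"
              consider "pr e' = Suc q" | "pr e' = q" | "pr e' < q" using e'(1) by linarith
              then show "e' \<in> {e. raceE_to s q \<kappa> c e \<in> split_at q Y (win s q Y)}"
              proof cases
                case 1
                then show ?thesis using e' clamp by (simp add: raceE_to_def split_at_def)
              next
                case 2
                then have "e' \<notin> below f c" using e' by (simp add: X_def split_at_def)
                then have "c \<in> f (below f e')" using not_below_step[OF f 1(2)] by blast
                then show ?thesis using C[of e'] 2 clamp \<open>pr c = q\<close> by (simp add: raceE_to_def split_at_def)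
              next
                case 3
                then have "e' \<notin> G" using e' by (simp add: X_def split_at_def)
                then show ?thesis using 3 exit[of e'] q by (simp add: raceE_to_def split_at_def)
              qed
            qed (use q in simp)
            then show "lev (\<not> s) (Suc q) X ?B \<subseteq> ?B"
              unfolding lev_def using RE[OF \<open>pr c = q\<close>, of _ s] Z_eq by blast
          qed
          finally show "RaceE s q \<kappa> e c \<in> win s q Y" by simp
        qed
      qed
      \<comment> \<open>The reversed invariant, kept by the opponent. Since \<open>q\<close> is good
        for the opponent, keeping it is enough: the fixed point is a greatest one.\<close>
      let ?B = "{RaceE s q \<kappa> e c | e c. pr c = q \<and> e \<in> f (below f c)} \<union>
        {RaceC s q \<kappa> c e | c e. pr e = q \<and> e \<in> lfp f \<and> c \<notin> f (below f e)}"
      let ?B' = "split_at q (- Y) ?B"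
      have "?B \<subseteq> lev (\<not> s) q (- Y) ?B"
      proof -
        have "RaceE s q \<kappa> e c \<in> win (\<not> s) (Suc q) ?B'" if c: "pr c = q" and e: "e \<in> f (below f c)" for e c
        proof -
          have "f (below f c) = win s (Suc (Suc q)) (split_at (Suc q) (split_at q G (below f c)) (f (below f c)))"
            using win_lev[of "Suc q" s] q by (simp add: f_eq lev_def)
          also have "\<dots> \<subseteq> win s (Suc (Suc q)) {e. raceE_to s q \<kappa> c e \<in> ?B'}"
          proof (rule win_mono)
            fix e' assume e': "pr e' < Suc (Suc q)"
              "e' \<in> split_at (Suc q) (split_at q G (below f c)) (f (below f c))"
            consider "pr e' = Suc q" | "pr e' = q" | "pr e' < q" using e'(1) by linarith
            then show "e' \<in> {e. raceE_to s q \<kappa> c e \<in> ?B'}"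
            proof cases
              case 1
              then show ?thesis using e' clamp c by (simp add: raceE_to_def split_at_def)
            next
              case 2
              then have b: "e' \<in> below f c" using e' by (simp add: split_at_def)
              then have "c \<notin> f (below f e')" "e' \<in> lfp f"
                using below_not_step[OF f] below_subset_lfp[OF f, of c] by blast+
              then show ?thesis using 2 c clamp by (simp add: raceE_to_def split_at_def)
            next
              case 3
              then have "e' \<in> G" using e' by (simp add: split_at_def)
              then show ?thesis using 3 exit[of e'] q by (simp add: raceE_to_def split_at_def)
            qed
          qed (use q in simp)
          finally show ?thesis using e RE[OF c, of e "\<not> s" ?B'] by auto
        qed
        moreover have "RaceC s q \<kappa> c e \<in> win (\<not> s) (Suc q) ?B'"
          if e: "pr e = q" "e \<in> lfp f" and c: "c \<notin> f (below f e)" for e c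
        proof -
          have "c \<in> win (\<not> s) (Suc q) (- split_at q G (below f e))"
            using c q by (simp add: f_eq win_Compl)
          also have "\<dots> \<subseteq> win (\<not> s) (Suc q) {c. raceC_to s q \<kappa> e c \<in> ?B'}"
          proof (rule win_mono)
            fix c' assume c': "pr c' < Suc q" "c' \<in> - split_at q G (below f e)"
            show "c' \<in> {c. raceC_to s q \<kappa> e c \<in> ?B'}"
            proof (cases "pr c' = q")
              case True
              then have "e \<in> f (below f c')"
                using c' not_below_step[OF f e(2)] by (simp add: split_at_def)
              then show ?thesis using True clamp e by (simp add: raceC_to_def split_at_def)
            next
              case F: False
              then show ?thesis using c' exit[of c'] by (simp add: raceC_to_def split_at_def)
            qed
          qed (use q in simp)
          finally show ?thesis using e RC[of e c "\<not> s" ?B'] by simp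
        qed
        ultimately show ?thesis unfolding lev_def by blast
      qed
      then have "?B \<subseteq> gfp (lev (\<not> s) q (- Y))" by (rule gfp_upperbound)
      also have "\<dots> = win (\<not> s) q (- Y)" using False q by (simp add: win_fixpt fixpt_def)
      also have "\<dots> = - win s q Y" using q by (simp add: win_Compl)
      finally have losing: "?B \<subseteq> - win s q Y" .
      have \<kappa>q: "\<kappa> q \<in> lfp f"
        using \<kappa> q False unfolding lfp_f by (simp add: ctx_ok_def q_def G_def)
      have "RaceE s q \<kappa> (\<kappa> q) c \<in> win s q Y \<longleftrightarrow> c \<in> below f (\<kappa> q)"
      proof
        assume "c \<in> below f (\<kappa> q)"
        then show "RaceE s q \<kappa> (\<kappa> q) c \<in> win s q Y"
          using winning[of c] q below_not_step[OF f] below_subset_lfp[OF f] by blast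
      next
        assume "RaceE s q \<kappa> (\<kappa> q) c \<in> win s q Y"
        then have "\<kappa> q \<notin> f (below f c)" using losing q by blast
        then show "c \<in> below f (\<kappa> q)" using not_below_step[OF f \<kappa>q] by blast
      qed
      then show ?thesis using False val_test good_c q by (simp add: test_def f_def)
    qed
  qed
qed

end

section \<open>The unambiguous automaton\<close>

definition limp :: "(nat \<Rightarrow> nat) \<Rightarrow> nat" where
  "limp r = (LEAST m. infinite {n. r n = m})"

lemma parity_acc_limp: "parity_acc r \<longleftrightarrow> even (limp r)"
  by (simp add: parity_acc_def limp_def)

lemma limp_infinite:
  assumes "\<And>n. r n \<le> B"
  shows "infinite {n. r n = limp r}"
proof -
  have "\<exists>m. infinite {n. r n = m}"
  proof (rule ccontr)
    assume "\<nexists>m. infinite {n. r n = m}"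
    then have "finite (\<Union>m\<in>{..B}. {n. r n = m})" by blast
    moreover have "(\<Union>m\<in>{..B}. {n. r n = m}) = UNIV" using assms by auto
    ultimately show False by simp
  qed
  then show ?thesis unfolding limp_def by (rule LeastI_ex)
qed

lemma limp_eventually_le: "\<exists>M. \<forall>n\<ge>M. limp r \<le> r n"
proof -
  have "finite {n. r n = m}" if "m < limp r" for m
    using not_less_Least[of m "\<lambda>m. infinite {n. r n = m}"] that unfolding limp_def by blast
  then have "finite (\<Union>m\<in>{..<limp r}. {n. r n = m})" by blast
  moreover have "(\<Union>m\<in>{..<limp r}. {n. r n = m}) = {n. r n < limp r}" by auto
  ultimately obtain M where "\<forall>n. r n < limp r \<longrightarrow> n \<le> M"
    using finite_nat_set_iff_bounded_le[of "{n. r n < limp r}"] by auto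
  then show ?thesis by (metis not_less Suc_n_not_le_n le_trans)
qed

lemma limp_eqI:
  assumes "infinite {n. r n = m}" "\<And>n. n \<ge> M \<Longrightarrow> m \<le> r n"
  shows "limp r = m"
  unfolding limp_def
proof (rule Least_equality)
  fix m' assume "infinite {n. r n = m'}"
  then obtain n where "n \<ge> M" "r n = m'" unfolding infinite_nat_iff_unbounded_le by blast
  then show "m \<le> m'" using assms(2) by blast
qed (rule assms)

lemma limp_affine_tail:
  assumes "\<And>n. r n \<le> B" "\<And>n. n \<ge> M \<Longrightarrow> r' (n + d) = r n + c"
  shows "limp r' = limp r + c"
proof -
  obtain K where K: "\<And>n. n \<ge> K \<Longrightarrow> limp r \<le> r n" using limp_eventually_le[of r] by blast
  show ?thesis
  proof (rule limp_eqI[where M = "max M K + d"])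
    fix n assume "max M K + d \<le> n"
    then show "limp r + c \<le> r' n"
      using assms(2)[of "n - d"] K[of "n - d"] by simp
  next
    show "infinite {n. r' n = limp r + c}"
      unfolding infinite_nat_iff_unbounded_le
    proof
      fix m
      obtain n where n: "n \<ge> max M m" "r n = limp r"
        using limp_infinite[of r, OF assms(1)] unfolding infinite_nat_iff_unbounded_le by blast
      then show "\<exists>k\<ge>m. k \<in> {n. r' n = limp r + c}"
        using assms(2)[of n] by (intro exI[of _ "n + d"]) auto
    qed
  qed
qed

text \<open>The letter 0 is unary and exchanges the roles of the players; the letter \<open>2 * p + of_bool a\<close>
  is a ternary position of player \<open>a\<close> and priority \<open>p\<close>, whose successors are the children 0 and 2,
  while child 1 decides which of them the player takes. In state \<open>st s j\<close> the automaton
  verifies that \<open>s\<close> wins; state 0 accepts every tree. The number \<open>j\<close> records the move that led to the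
  node: 0 for a middle child, 1 for an exchange of roles, \<open>Suc p\<close> for a successor of a position of
  priority \<open>p\<close>.\<close>

definition letters :: "nat \<Rightarrow> nat set" where
  "letters n = insert 0 {2..Suc (2 * n)}"

definition arity :: "nat \<Rightarrow> nat" where
  "arity a = (if a = 0 then 1 else 3)"

definition st :: "bool \<Rightarrow> nat \<Rightarrow> nat" where
  "st s j = Suc (2 * j + of_bool s)"

text \<open>Code \<open>st s (Suc p)\<close> with \<open>p\<close> positive gets
  \<open>p + 2\<close>, plus one for \<open>s = False\<close>, which is even iff \<open>p\<close> is
  good for \<open>s\<close>. Infinitely many middle moves accept; otherwise infinitely many
  exchanges reject.\<close>

definition prio :: "nat \<Rightarrow> nat" where
  "prio q = (if q \<le> 4 then (q - 1) div 2 else (q - 1) div 2 + 1 + of_bool (odd q))"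

definition moves :: "bool \<Rightarrow> nat \<Rightarrow> nat list set" where
  "moves s a = (if a = 0 then {[st (\<not> s) 1]}
     else if odd a = s then {[st s (Suc (a div 2)), st s 0, 0], [0, st (\<not> s) 0, st s (Suc (a div 2))]}
     else {[st s (Suc (a div 2)), 0, st s (Suc (a div 2))]})"

definition mode_trans :: "nat \<Rightarrow> (nat \<times> nat \<times> nat list) set" where
  "mode_trans n = {(0, a, replicate (arity a) 0) | a. a \<in> letters n} \<union>
     {(st s j, a, qs) | s j a qs. j \<le> Suc n \<and> a \<in> letters n \<and> qs \<in> moves s a}"

lemma st_neq_0 [simp]: "st s j \<noteq> 0" "0 \<noteq> st s j"
  by (simp_all add: st_def)

lemma st_inject [simp]: "st s j = st s' j' \<longleftrightarrow> s = s' \<and> j = j'"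
  by (cases s; cases s') (auto simp: st_def, presburger+)

lemma prio_st: "prio (st s j) = (if j \<le> 1 then j else j + 1 + of_bool (\<not> s))"
  by (cases s) (auto simp: prio_def st_def)

lemma prio_0 [simp]: "prio 0 = 0"
  by (simp add: prio_def)

lemma npta_mode_trans: "npta (letters n) arity {..2 * n + 4} (mode_trans n) {st True 0} prio"
proof -
  have *: "length qs = arity a \<and> set qs \<subseteq> {..2 * n + 4}" if "a \<in> letters n" "qs \<in> moves s a" for a qs s
  proof -
    have "a div 2 \<le> n" using that(1) by (auto simp: letters_def)
    then show ?thesis
      using that(2) by (auto simp: moves_def st_def arity_def of_bool_def split: if_splits)
  qed
  moreover have "st s j \<le> 2 * n + 4" if "j \<le> Suc n" for s j
    using that by (cases s) (auto simp: st_def)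
  ultimately show ?thesis
    unfolding npta_def mode_trans_def by fastforce
qed

lemma upt_3: "[0..<3] = [0, 1, 2::nat]"
  by (simp add: upt_rec)

section \<open>Runs with opposite claims, and unambiguity\<close>

lemma run_moves:
  assumes "npta_run arity (mode_trans n) I t \<rho>" "t u = Some a" "\<rho> u = st s j"
  shows "if a = 0 then \<rho> (u @ [0]) = st (\<not> s) 1
     else if odd a = s then
       \<rho> (u @ [0]) = st s (Suc (a div 2)) \<and> \<rho> (u @ [1]) = st s 0 \<and> \<rho> (u @ [2]) = 0 \<or>
       \<rho> (u @ [0]) = 0 \<and> \<rho> (u @ [1]) = st (\<not> s) 0 \<and> \<rho> (u @ [2]) = st s (Suc (a div 2))
     else \<rho> (u @ [0]) = st s (Suc (a div 2)) \<and> \<rho> (u @ [1]) = 0 \<and> \<rho> (u @ [2]) = st s (Suc (a div 2))"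
proof -
  have "(st s j, a, map (\<lambda>i. \<rho> (u @ [i])) [0..<arity a]) \<in> mode_trans n"
    using assms unfolding npta_run_def by metis
  then have "map (\<lambda>i. \<rho> (u @ [i])) [0..<arity a] \<in> moves s a"
    by (auto simp: mode_trans_def)
  then show ?thesis by (auto simp: moves_def arity_def upt_3 split: if_splits)
qed

lemma run_state:
  assumes "npta_run arity (mode_trans n) I t \<rho>" "t u = Some a"
  shows "\<rho> u = 0 \<and> (\<forall>i<arity a. \<rho> (u @ [i]) = 0) \<or> (\<exists>s j. j \<le> Suc n \<and> \<rho> u = st s j)"
proof -
  have "(\<rho> u, a, map (\<lambda>i. \<rho> (u @ [i])) [0..<arity a]) \<in> mode_trans n"
    using assms by (auto simp: npta_run_def)
  then consider "\<rho> u = 0" "map (\<lambda>i. \<rho> (u @ [i])) [0..<arity a] = replicate (arity a) 0"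
    | "\<exists>s j. j \<le> Suc n \<and> \<rho> u = st s j"
    by (auto simp: mode_trans_def)
  then show ?thesis
  proof cases
    case 1
    then have "\<rho> (u @ [i]) = 0" if "i < arity a" for i
      using that 1(2) by (simp add: list_eq_iff_nth_eq)
    then show ?thesis using 1 by simp
  qed simp
qed

text \<open>At a ternary node the run of the owner picks one successor and the other run follows
  both, so they meet at child 0 or 2, never at the middle child.\<close>

lemma joint_step:
  assumes "npta_run arity (mode_trans n) I1 t \<rho>1" "npta_run arity (mode_trans n) I2 t \<rho>2" "t u = Some a"
    and "\<rho>1 u = st s j" "\<rho>2 u = st (\<not> s) j'"
  shows "\<exists>d s' i. d < arity a \<and> \<rho>1 (u @ [d]) = st s' i \<and> \<rho>2 (u @ [d]) = st (\<not> s') i \<and>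
    i \<noteq> 0 \<and> (i = 1 \<or> s' = s)"
proof (cases "a = 0")
  case True
  then show ?thesis using run_moves[OF assms(1,3,4)] run_moves[OF assms(2,3,5)]
    by (intro exI[of _ 0] exI[of _ "\<not> s"] exI[of _ 1]) (simp add: arity_def)
next
  case False
  have "\<exists>d\<in>{0, 2}. \<rho>1 (u @ [d]) = st s (Suc (a div 2)) \<and> \<rho>2 (u @ [d]) = st (\<not> s) (Suc (a div 2))"
    using run_moves[OF assms(1,3,4)] run_moves[OF assms(2,3,5)] False by (cases s) (auto split: if_splits)
  then obtain d where "d \<in> {0, 2}" "\<rho>1 (u @ [d]) = st s (Suc (a div 2))"
    "\<rho>2 (u @ [d]) = st (\<not> s) (Suc (a div 2))" by blast
  then show ?thesis using False
    by (intro exI[of _ d] exI[of _ s] exI[of _ "Suc (a div 2)"]) (auto simp: arity_def)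
qed

lemma tree_prefix: "is_tree A ar t \<Longrightarrow> t (u @ v) \<noteq> None \<Longrightarrow> t u \<noteq> None"
proof (induction v rule: rev_induct)
  case (snoc i v)
  then show ?case unfolding is_tree_def by (metis append.assoc)
qed simp

lemma branch_of_nodes:
  assumes "\<And>m. \<exists>d. f (Suc m) = f m @ [d]"
  shows "\<exists>\<beta>. \<forall>m. map \<beta> [0..<length (f 0) + m] = f m"
proof -
  obtain d where d: "\<And>m. f (Suc m) = f m @ [d m]" using assms by metis
  define \<beta> where "\<beta> i = (if i < length (f 0) then f 0 ! i else d (i - length (f 0)))" for i
  have "map \<beta> [0..<length (f 0) + m] = f m" for m
  proof (induction m)
    case 0
    show ?case by (rule nth_equalityI) (auto simp: \<beta>_def)
  next
    case (Suc m)
    then show ?case by (simp add: d \<beta>_def)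
  qed
  then show ?thesis by blast
qed

text \<open>Infinitely many exchanges make priority 1 the least recurrent one; otherwise the modes
  become constant and the two limits differ by exactly one.\<close>

lemma opposite_modes_not_both_accepting:
  assumes j: "\<And>m. j m \<noteq> 0" "\<And>m. j m \<le> B" and s: "\<And>m. j (Suc m) = 1 \<or> s (Suc m) = s m"
  shows "\<not> (even (limp (\<lambda>m. prio (st (s m) (j m)))) \<and> even (limp (\<lambda>m. prio (st (\<not> s m) (j m)))))"
proof (cases "infinite {m. j m = 1}")
  case True
  have "limp (\<lambda>m. prio (st (s m) (j m))) = 1"
  proof (rule limp_eqI)
    show "infinite {m. prio (st (s m) (j m)) = 1}"
      by (rule infinite_super[OF _ True]) (auto simp: prio_st)
    show "1 \<le> prio (st (s m) (j m))" for m using j(1)[of m] by (simp add: prio_st)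
  qed
  then show ?thesis by simp
next
  case False
  then obtain M where "\<forall>m. j m = 1 \<longrightarrow> m < M"
    using finite_nat_set_iff_bounded[of "{m. j m = 1}"] by auto
  then have j2: "\<not> j m \<le> 1" if "m \<ge> M" for m using j(1)[of m] that by (metis le_Suc_eq One_nat_def le_zero_eq not_less)
  have const: "s m = s M" if "m \<ge> M" for m
    using that
  proof (induction m rule: dec_induct)
    case (step m)
    then show ?case using s[of m] j2[of "Suc m"] by auto
  qed simp
  have "limp (\<lambda>m. prio (st (s m) (j m))) = limp j + (1 + of_bool (\<not> s M))"
  proof (rule limp_affine_tail[where d = 0 and M = M, OF j(2)])
    fix m assume m: "M \<le> m"
    show "prio (st (s (m + 0)) (j (m + 0))) = j m + (1 + of_bool (\<not> s M))"
      using j2[OF m] const[OF m] by (simp add: prio_st)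
  qed
  moreover have "limp (\<lambda>m. prio (st (\<not> s m) (j m))) = limp j + (1 + of_bool (s M))"
  proof (rule limp_affine_tail[where d = 0 and M = M, OF j(2)])
    fix m assume m: "M \<le> m"
    show "prio (st (\<not> s (m + 0)) (j (m + 0))) = j m + (1 + of_bool (s M))"
      using j2[OF m] const[OF m] by (simp add: prio_st)
  qed
  ultimately show ?thesis by auto
qed

lemma modes_disjoint:
  assumes t: "is_tree A arity t"
    and acc1: "npta_acc_run arity (mode_trans n) I1 prio t \<rho>1" and acc2: "npta_acc_run arity (mode_trans n) I2 prio t \<rho>2"
    and u: "t u \<noteq> None" "\<rho>1 u = st s j" "\<rho>2 u = st (\<not> s) j'"
  shows False
proof -
  have run: "npta_run arity (mode_trans n) I1 t \<rho>1" "npta_run arity (mode_trans n) I2 t \<rho>2"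
    using acc1 acc2 by (auto simp: npta_acc_run_def)
  let ?P = "\<lambda>m v. t v \<noteq> None \<and> (m = 0 \<longrightarrow> v = u) \<and> (\<exists>s j j'. \<rho>1 v = st s j \<and> \<rho>2 v = st (\<not> s) j')"
  let ?Q = "\<lambda>v w. (\<exists>d. w = v @ [d]) \<and> (\<forall>s j. \<rho>1 v = st s j \<longrightarrow>
     (\<exists>s' i. \<rho>1 w = st s' i \<and> \<rho>2 w = st (\<not> s') i \<and> i \<noteq> 0 \<and> (i = 1 \<or> s' = s)))"
  have "\<exists>f. \<forall>m. ?P m (f m) \<and> ?Q (f m) (f (Suc m))"
  proof (rule dependent_nat_choice)
    show "\<exists>v. ?P 0 v" using u by blast
  next
    fix v and m :: nat assume P: "?P m v"
    then obtain a s j j' where v: "t v = Some a" "\<rho>1 v = st s j" "\<rho>2 v = st (\<not> s) j'" by blast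
    obtain d s' i where d: "d < arity a" "\<rho>1 (v @ [d]) = st s' i" "\<rho>2 (v @ [d]) = st (\<not> s') i"
      "i \<noteq> 0" "i = 1 \<or> s' = s"
      using joint_step[OF run v] by blast
    have "t (v @ [d]) \<noteq> None" using t v(1) d(1) by (auto simp: is_tree_def)
    then show "\<exists>w. ?P (Suc m) w \<and> ?Q v w"
      using v d by (intro exI[of _ "v @ [d]"]) auto
  qed
  then obtain f where choice: "\<forall>m. ?P m (f m) \<and> ?Q (f m) (f (Suc m))" ..
  note f = conjunct1[OF spec[OF choice]] conjunct2[OF spec[OF choice]]
  have "\<exists>si. \<rho>1 (f (Suc m)) = st (fst si) (snd si) \<and> \<rho>2 (f (Suc m)) = st (\<not> fst si) (snd si) \<and> snd si \<noteq> 0" for m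
    using f(1)[of m] f(2)[of m] by fastforce
  then obtain si where si: "\<And>m. \<rho>1 (f (Suc m)) = st (fst (si m)) (snd (si m))"
    "\<And>m. \<rho>2 (f (Suc m)) = st (\<not> fst (si m)) (snd (si m))" "\<And>m. snd (si m) \<noteq> 0"
    by metis
  have mode: "snd (si (Suc m)) = 1 \<or> fst (si (Suc m)) = fst (si m)" for m
    using f(2)[of "Suc m"] si by auto
  have bound: "snd (si m) \<le> Suc n" for m
    using f(1)[of "Suc m"] run_state[OF run(1), of "f (Suc m)"] si(1)[of m] by auto
  obtain \<beta> where \<beta>: "\<And>m. map \<beta> [0..<length u + m] = f m"
    using branch_of_nodes[of f] f by metis
  have branch: "is_branch t \<beta>"
    unfolding is_branch_def
  proof
    fix m
    have "map \<beta> [0..<length u + m] = map \<beta> [0..<m] @ map \<beta> [m..<length u + m]"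
      by (metis add.commute le_add1 map_append upt_add_eq_append zero_le add_0)
    then show "t (map \<beta> [0..<m]) \<noteq> None"
      using tree_prefix[OF t, of "map \<beta> [0..<m]"] f(1)[of m] \<beta>[of m] by metis
  qed
  have B: "prio (st (s m) (snd (si m))) \<le> n + 3" for s m
    using bound[of m] by (simp add: prio_st)
  have tail: "limp (\<lambda>m. prio (\<rho> (map \<beta> [0..<m]))) = limp (\<lambda>m. prio (\<rho> (f (Suc m))))"
    if "\<And>m. prio (\<rho> (f (Suc m))) \<le> n + 3" for \<rho>
    using limp_affine_tail[where M = 0 and c = 0 and d = "Suc (length u)" and
        r = "\<lambda>m. prio (\<rho> (f (Suc m)))" and r' = "\<lambda>m. prio (\<rho> (map \<beta> [0..<m]))", OF that]
      \<beta>[of "Suc _"] by (simp add: add.commute del: upt_Suc)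
  show False
    using acc1 acc2 branch tail[of \<rho>1] tail[of \<rho>2] B[of "\<lambda>m. fst (si m)"] B[of "\<lambda>m. \<not> fst (si m)"]
      opposite_modes_not_both_accepting[of "\<lambda>m. snd (si m)" "Suc n" "\<lambda>m. fst (si m)", OF si(3) bound mode]
    by (auto simp: npta_acc_run_def parity_acc_limp si)
qed

lemma unambiguous_mode_trans: "npta_unambiguous (letters n) arity (mode_trans n) {st True 0} prio"
  unfolding npta_unambiguous_def
proof (intro allI impI, elim conjE)
  fix t \<rho>1 \<rho>2 u
  assume t: "is_tree (letters n) arity t"
    and acc: "npta_acc_run arity (mode_trans n) {st True 0} prio t \<rho>1" "npta_acc_run arity (mode_trans n) {st True 0} prio t \<rho>2"
    and "t u \<noteq> None"
  have run: "npta_run arity (mode_trans n) {st True 0} t \<rho>1" "npta_run arity (mode_trans n) {st True 0} t \<rho>2"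
    using acc by (auto simp: npta_acc_run_def)
  show "\<rho>1 u = \<rho>2 u"
    using \<open>t u \<noteq> None\<close>
  proof (induction u rule: rev_induct)
    case Nil
    then show ?case using run by (auto simp: npta_run_def)
  next
    case (snoc i u)
    then obtain a where a: "t u = Some a" "i < arity a"
      using t unfolding is_tree_def by (metis not_None_eq)
    have eq: "\<rho>1 u = \<rho>2 u" using snoc a by simp
    show ?case
    proof (cases "\<rho>1 u = 0")
      case True
      then show ?thesis using run_state[OF run(1) a(1)] run_state[OF run(2) a(1)] eq a(2) by auto
    next
      case False
      then obtain s j where s: "\<rho>1 u = st s j" "\<rho>2 u = st s j" using run_state[OF run(1) a(1)] eq by auto
      have mid: "\<not> (\<rho>1 (u @ [1]) = st s' 0 \<and> \<rho>2 (u @ [1]) = st (\<not> s') 0)" if "a \<noteq> 0" for s'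
        using modes_disjoint[OF t acc, of "u @ [1]" s' 0 0] a t that by (auto simp: is_tree_def arity_def)
      have "i = 0 \<or> a \<noteq> 0 \<and> i = 1 \<or> a \<noteq> 0 \<and> i = 2"
        using a(2) by (auto simp: arity_def split: if_splits)
      then show ?thesis
        using run_moves[OF run(1) a(1) s(1)] run_moves[OF run(2) a(1) s(2)] mid[of s] mid[of "\<not> s"]
        by (auto split: if_splits)
    qed
  qed
qed

section \<open>The diagonal tree\<close>

context term_game
begin

declare good.simps(2) [simp del]

definition child :: "nat \<Rightarrow> trm \<times> (bool \<Rightarrow> nat \<Rightarrow> trm) \<Rightarrow> trm \<times> (bool \<Rightarrow> nat \<Rightarrow> trm)" where
  "child d z = kid d (own (fst z)) (snd z) (nx True (fst z)) (nx False (fst z))"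

definition node :: "nat list \<Rightarrow> trm \<times> (bool \<Rightarrow> nat \<Rightarrow> trm)" where
  "node u = foldl (\<lambda>z d. child d z) (Root, fresh Root) u"

lemma node_simps [simp]: "node [] = (Root, fresh Root)" "node (u @ [d]) = child d (node u)"
  by (simp_all add: node_def)

definition valid :: "nat list \<Rightarrow> bool" where
  "valid u \<longleftrightarrow> (\<forall>i<length u. u ! i < arity (lab (fst (node (take i u)))))"

lemma valid_simps [simp]: "valid []" "valid (u @ [d]) \<longleftrightarrow> valid u \<and> d < arity (lab (fst (node u)))"
  by (auto simp: valid_def nth_append less_Suc_eq)

definition wtree :: "nat list \<Rightarrow> nat option" where
  "wtree u = (if valid u then Some (lab (fst (node u))) else None)"

lemma lab_letters: "lab y \<in> letters n"
  using pr_le[of y] by (auto simp: lab_def letters_def of_bool_def)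

lemma lab_facts: "lab y = 0 \<longleftrightarrow> pr y = 0" "pr y \<noteq> 0 \<Longrightarrow> lab y div 2 = pr y" "pr y \<noteq> 0 \<Longrightarrow> odd (lab y) = own y"
  by (auto simp: lab_def of_bool_def)

lemma is_tree_wtree: "is_tree (letters n) arity wtree"
  by (auto simp: is_tree_def wtree_def lab_letters split: if_splits)

section \<open>The canonical run on the diagonal tree\<close>

definition next_mode :: "trm \<times> (bool \<Rightarrow> nat \<Rightarrow> trm) \<Rightarrow> (bool \<times> nat) option \<Rightarrow> nat \<Rightarrow> (bool \<times> nat) option" where
  "next_mode z r d = (case r of None \<Rightarrow> None | Some (s, j) \<Rightarrow>
     let y = fst z in
     if pr y = 0 then Some (\<not> s, 1)
     else if own y = s then
       if nx True y \<in> good s (snd z s) (Suc n)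
       then (if d = 0 then Some (s, Suc (pr y)) else if d = 1 then Some (s, 0) else None)
       else (if d = 0 then None else if d = 1 then Some (\<not> s, 0) else Some (s, Suc (pr y)))
     else if d = 1 then None else Some (s, Suc (pr y)))"

definition mode :: "bool \<Rightarrow> nat list \<Rightarrow> (bool \<times> nat) option" where
  "mode s u = snd (foldl (\<lambda>(z, r) d. (child d z, next_mode z r d)) ((Root, fresh Root), Some (s, 0)) u)"

lemma mode_simps [simp]: "mode s [] = Some (s, 0)" "mode s (u @ [d]) = next_mode (node u) (mode s u) d"
proof -
  have "fst (foldl (\<lambda>(z, r) d. (child d z, next_mode z r d)) ((Root, fresh Root), Some (s, 0)) u) = node u"
    by (induction u rule: rev_induct) (auto simp: case_prod_beta)
  then show "mode s (u @ [d]) = next_mode (node u) (mode s u) d"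
    by (simp add: mode_def case_prod_beta)
qed (simp add: mode_def)

text \<open>At an exchange the other player takes over; this is safe because both contexts are then
  reset to the position itself.\<close>

definition sound :: "bool \<Rightarrow> trm \<times> (bool \<Rightarrow> nat \<Rightarrow> trm) \<Rightarrow> bool" where
  "sound s z \<longleftrightarrow> (if pr (fst z) = 0 then val (fst z) = s \<and> snd z = (\<lambda>_ _. fst z)
     else secure s (fst z) (snd z s))"

lemma sound_fresh:
  assumes "val y = s"
  shows "sound s (y, fresh y)"
proof (cases "pr y = 0")
  case True
  then show ?thesis using assms by (simp add: sound_def fresh_def ctx_upd_zero)
next
  case False
  have "y \<in> good s (\<lambda>_. Sw y) (Suc n)" "ctx_ok s (\<lambda>_. Sw y)"
    using good_fresh[of "Sw y" True s] assms by simp_all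
  then show ?thesis using good_step[of s _ y] False by (simp add: sound_def fresh_def)
qed

lemma sound_step:
  assumes "secure s y (\<kappa> s)" "c \<in> good s (\<kappa> s) (Suc n)"
  shows "sound s (c, \<lambda>s. ctx_upd pr (\<kappa> s) c)"
proof (cases "pr c = 0")
  case True
  then show ?thesis using good_val[OF assms(2)] by (simp add: sound_def ctx_upd_zero)
next
  case False
  then show ?thesis using good_step[of s "\<kappa> s" c] assms by (simp add: sound_def secure_def)
qed

lemma sound_move:
  assumes "sound s (y, \<kappa>)" "pr y \<noteq> 0" "next_mode (y, \<kappa>) (Some (s, j)) d = Some (s', j')" "j' \<noteq> 0"
  shows "s' = s \<and> j' = Suc (pr y) \<and> (\<exists>b. child d (y, \<kappa>) = (nx b y, \<lambda>s. ctx_upd pr (\<kappa> s) (nx b y)) \<and>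
     nx b y \<in> good s (\<kappa> s) (Suc n))"
proof -
  have "y \<in> pre s (good s (\<kappa> s) (Suc n))" using assms by (simp add: sound_def secure_def)
  moreover have "d = 0 \<or> d \<noteq> 1 \<and> d \<noteq> 0" using assms(2-) by (auto simp: next_mode_def split: if_splits)
  moreover have "child 0 (y, \<kappa>) = (nx True y, \<lambda>s. ctx_upd pr (\<kappa> s) (nx True y))"
    "\<And>d. d \<noteq> 1 \<Longrightarrow> d \<noteq> 0 \<Longrightarrow> child d (y, \<kappa>) = (nx False y, \<lambda>s. ctx_upd pr (\<kappa> s) (nx False y))"
    by (auto simp: child_def kid_def)
  ultimately show ?thesis
    using assms(2-)
    by (auto simp: next_mode_def pre_def all_bool_eq ex_bool_eq split: if_splits)
qed

lemma sound_child:
  assumes z: "sound s (y, \<kappa>)" and d: "d < arity (lab y)"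
    and r: "next_mode (y, \<kappa>) (Some (s, j)) d = Some (s', j')"
  shows "sound s' (child d (y, \<kappa>))"
proof (cases "pr y = 0")
  case True
  then obtain t where y: "y = Sw t" by (auto simp: pr_eq_0_iff)
  have "d = 0" using d True by (simp add: arity_def lab_def)
  then have "child d (y, \<kappa>) = (t, fresh t)"
    using z y by (simp add: child_def kid_def sound_def fresh_def)
  moreover have "val t = (\<not> s)" using val_zero[of y True] z y by (auto simp: sound_def)
  ultimately show ?thesis using sound_fresh[of t "\<not> s"] r True by (auto simp: next_mode_def)
next
  case False
  then have sec: "secure s y (\<kappa> s)" using z by (simp add: sound_def)
  show ?thesis
  proof (cases "j' = 0")
    case True
    then have d1: "d = 1" "own y = s" and s': "s' = (if nx True y \<in> good s (\<kappa> s) (Suc n) then s else \<not> s)"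
      using r False by (auto simp: next_mode_def split: if_splits)
    have "val (test s (\<kappa> s) (nx True y)) = s'"
      using test_val[of s "\<kappa> s" "nx True y"] sec s' by (auto simp: secure_def split: if_splits)
    then show ?thesis using sound_fresh d1 by (auto simp: child_def kid_def)
  next
    case F: False
    then show ?thesis using sound_move[OF z False r F] sound_step[of s y \<kappa>] sec by auto
  qed
qed

lemma mode_sound:
  assumes "val Root = s0" "valid u" "mode s0 u = Some (s, j)"
  shows "sound s (node u) \<and> j \<le> Suc n"
  using assms(2,3)
proof (induction u arbitrary: s j rule: rev_induct)
  case Nil
  then show ?case using sound_fresh assms(1) by auto
next
  case (snoc d u)
  obtain y \<kappa> where y: "node u = (y, \<kappa>)" by fastforce
  obtain s' j' where s': "mode s0 u = Some (s', j')"
    using snoc.prems by (cases "mode s0 u") (auto simp: next_mode_def)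
  have "sound s' (node u)" using snoc s' by auto
  then show ?case
    using sound_child[of s' y \<kappa> d j' s j] snoc.prems s' y pr_le[of y]
    by (auto simp: next_mode_def split: if_splits)
qed

definition state :: "(bool \<times> nat) option \<Rightarrow> nat" where
  "state r = (case r of None \<Rightarrow> 0 | Some (s, j) \<Rightarrow> st s j)"

lemma state_simps [simp]: "state None = 0" "state (Some (s, j)) = st s j"
  by (simp_all add: state_def)

lemma canonical_run:
  assumes "val Root = s0"
  shows "npta_run arity (mode_trans n) {st s0 0} wtree (\<lambda>u. state (mode s0 u))"
  unfolding npta_run_def
proof (intro conjI allI impI)
  fix u a assume "wtree u = Some a"
  then have u: "valid u" and a: "a = lab (fst (node u))" by (auto simp: wtree_def split: if_splits)
  obtain y \<kappa> where y: "node u = (y, \<kappa>)" by fastforce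
  show "(state (mode s0 u), a, map (\<lambda>i. state (mode s0 (u @ [i]))) [0..<arity a]) \<in> mode_trans n"
  proof (cases "mode s0 u")
    case None
    then have "map (\<lambda>i. state (mode s0 (u @ [i]))) [0..<arity a] = replicate (arity a) 0"
      by (simp add: next_mode_def map_replicate_const)
    then show ?thesis using None a lab_letters by (auto simp: mode_trans_def)
  next
    case (Some r)
    obtain s j where r: "r = (s, j)" by fastforce
    have "map (\<lambda>i. state (mode s0 (u @ [i]))) [0..<arity a] \<in> moves s a"
    proof (cases "pr y = 0")
      case True
      then show ?thesis using a y Some r lab_facts(1)[of y] by (simp add: next_mode_def moves_def arity_def)
    next
      case False
      then have "a \<noteq> 0" "a div 2 = pr y" "odd a = own y" using a y lab_facts[of y] by auto
      then show ?thesis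
        using False y Some r by (auto simp: next_mode_def moves_def arity_def upt_3)
    qed
    moreover have "j \<le> Suc n" using mode_sound[OF assms u] Some r by simp
    ultimately show ?thesis using Some r a lab_letters by (auto simp: mode_trans_def)
  qed
qed simp

text \<open>A branch may end in the accept-all state or take infinitely many middle children, and
  then sees priority 0 forever or recurrently. Any other branch is eventually a play with finitely
  many exchanges, to which \<open>path_parity\<close> applies.\<close>

lemma canonical_run_accepting:
  assumes "val Root = s0"
  shows "npta_acc_run arity (mode_trans n) {st s0 0} prio wtree (\<lambda>u. state (mode s0 u))"
  unfolding npta_acc_run_def
proof (intro conjI allI impI canonical_run[OF assms])
  fix \<beta> assume "is_branch wtree \<beta>"
  define v where "v m = map \<beta> [0..<m]" for m
  have v: "valid (v m)" "v (Suc m) = v m @ [\<beta> m]" for m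
    using \<open>is_branch wtree \<beta>\<close> by (auto simp: is_branch_def wtree_def v_def split: if_splits)
  define y where "y m = fst (node (v m))" for m
  define \<kappa> where "\<kappa> m = snd (node (v m))" for m
  have node: "node (v m) = (y m, \<kappa> m)" for m by (simp add: y_def \<kappa>_def)
  have step: "mode s0 (v (Suc m)) = next_mode (y m, \<kappa> m) (mode s0 (v m)) (\<beta> m)"
    "(y (Suc m), \<kappa> (Suc m)) = child (\<beta> m) (y m, \<kappa> m)" "\<beta> m < arity (lab (y m))" for m
  proof -
    have "node (v (Suc m)) = child (\<beta> m) (node (v m))" by (simp add: v(2))
    then show "(y (Suc m), \<kappa> (Suc m)) = child (\<beta> m) (y m, \<kappa> m)" unfolding node .
    show "mode s0 (v (Suc m)) = next_mode (y m, \<kappa> m) (mode s0 (v m)) (\<beta> m)"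
      by (simp add: v(2) node)
    show "\<beta> m < arity (lab (y m))" using v(1)[of "Suc m"] unfolding v(2) by (simp add: node)
  qed
  have "even (limp (\<lambda>m. prio (state (mode s0 (v m)))))"
  proof (cases "\<exists>m. mode s0 (v m) = None")
    case True
    then obtain m0 where m0: "mode s0 (v m0) = None" by blast
    have "mode s0 (v m) = None" if "m \<ge> m0" for m
      using that by (induction m rule: dec_induct) (auto simp: m0 step next_mode_def)
    then have "{m0..} \<subseteq> {m. prio (state (mode s0 (v m))) = 0}" by auto
    then have "infinite {m. prio (state (mode s0 (v m))) = 0}" using infinite_Ici infinite_super by blast
    then have "limp (\<lambda>m. prio (state (mode s0 (v m)))) = 0" by (rule limp_eqI) simp
    then show ?thesis by simp
  next
    case False
    then have "\<forall>m. \<exists>sj. mode s0 (v m) = Some sj" by auto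
    then obtain sj where sj: "\<And>m. mode s0 (v m) = Some (sj m)" by metis
    define s where "s m = fst (sj m)" for m
    define j where "j m = snd (sj m)" for m
    have mode: "mode s0 (v m) = Some (s m, j m)" for m by (simp add: sj s_def j_def)
    have sound: "sound (s m) (y m, \<kappa> m)" for m
      using mode_sound[OF assms v(1) mode] by (simp add: node)
    have next_eq: "next_mode (y m, \<kappa> m) (Some (s m, j m)) (\<beta> m) = Some (s (Suc m), j (Suc m))" for m
      using step(1)[of m] by (simp add: mode)
    show ?thesis
    proof (cases "infinite {m. j m = 0}")
      case True
      have "infinite {m. prio (state (mode s0 (v m))) = 0}"
        by (rule infinite_super[OF _ True]) (auto simp: mode prio_st)
      then have "limp (\<lambda>m. prio (state (mode s0 (v m)))) = 0" by (rule limp_eqI) simp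
      then show ?thesis by simp
    next
      case False
      then obtain M where M: "\<And>m. m \<ge> M \<Longrightarrow> j m \<noteq> 0"
        using finite_nat_set_iff_bounded[of "{m. j m = 0}"] by (auto simp: not_less[symmetric])
      have "\<exists>b. y (Suc m) = nx b (y m)" if "m \<ge> M" for m
      proof (cases "pr (y m) = 0")
        case True
        then have "\<beta> m = 0" using step(3)[of m] by (simp add: arity_def lab_def)
        then show ?thesis using step(2)[of m] by (auto simp: child_def kid_def)
      next
        case False
        then show ?thesis
          using sound_move[OF sound False next_eq M] that step(2)[of m] by auto
      qed
      then have "finite {m. pr (y m) = 0}" by (rule finite_zeros_on_path[OF wf_next_zero])
      then obtain M0 where M0: "\<And>m. m \<ge> M0 \<Longrightarrow> pr (y m) \<noteq> 0"
        using finite_nat_set_iff_bounded[of "{m. pr (y m) = 0}"] by (auto simp: not_less[symmetric])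
      define K where "K = max M M0"
      define \<sigma> where "\<sigma> = s K"
      have move: "s (Suc m) = s m \<and> j (Suc m) = Suc (pr (y m)) \<and> y (Suc m) \<in> good (s m) (\<kappa> m (s m)) (Suc n) \<and>
          \<kappa> (Suc m) = (\<lambda>s. ctx_upd pr (\<kappa> m s) (y (Suc m)))" if "m \<ge> K" for m
        using sound_move[OF sound _ next_eq, of m] M[of "Suc m"] M0[of m] that step(2)[of m]
        by (auto simp: K_def)
      have const: "s m = \<sigma>" if "m \<ge> K" for m
        using that by (induction m rule: dec_induct) (auto simp: move \<sigma>_def)
      have "limp (\<lambda>m. prio (state (mode s0 (v m)))) = limp (\<lambda>m. pr (y m)) + (2 + of_bool (\<not> \<sigma>))"
      \<comment> \<open>The state at a node records the priority of its parent, hence the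
        shift.\<close>
      proof (rule limp_affine_tail[where d = 1 and M = K])
        fix m assume m: "K \<le> m"
        then show "prio (state (mode s0 (v (m + 1)))) = pr (y m) + (2 + of_bool (\<not> \<sigma>))"
          using move[OF m] const[of "Suc m"] M0[of m] by (simp add: mode prio_st K_def)
      qed (rule pr_le)
      moreover have "even (limp (\<lambda>m. pr (y m))) = \<sigma>"
      proof -
        have inf: "infinite {m. pr (y m) = limp (\<lambda>m. pr (y m))}" by (rule limp_infinite[OF pr_le])
        then obtain m where "m \<ge> M0" "pr (y m) = limp (\<lambda>m. pr (y m))"
          unfolding infinite_nat_iff_unbounded_le by blast
        then have nz: "limp (\<lambda>m. pr (y m)) \<noteq> 0" "limp (\<lambda>m. pr (y m)) < Suc (Suc n)"
          using M0[of m] pr_le[of "y m"] by auto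
        obtain M1 where M1: "\<And>m. m \<ge> M1 \<Longrightarrow> limp (\<lambda>m. pr (y m)) \<le> pr (y m)"
          using limp_eventually_le by blast
        show ?thesis
        proof (rule path_parity[where start = "max K M1" and \<kappa> = "\<lambda>m. \<kappa> m \<sigma>" and x = y, OF _ nz _ inf])
          fix m assume "max K M1 \<le> m"
          then show "limp (\<lambda>m. pr (y m)) \<le> pr (y (Suc m))" using M1 by simp
        next
          fix m assume "max K M1 \<le> m"
          then show "\<exists>\<kappa>'. (\<forall>q<Suc (Suc n). \<kappa>' q = \<kappa> m \<sigma> q) \<and> y (Suc m) \<in> good \<sigma> \<kappa>' (Suc n) \<and>
              \<kappa> (Suc m) \<sigma> = ctx_upd pr \<kappa>' (y (Suc m))"
            using move[of m] const[of m] by (intro exI[of _ "\<kappa> m \<sigma>"]) auto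
        qed
      qed
      ultimately show ?thesis by auto
    qed
  qed
  then show "parity_acc (\<lambda>m. prio (state (mode s0 (map \<beta> [0..<m]))))"
    by (simp add: parity_acc_limp v_def)
qed

text \<open>For the converse, if \<open>False\<close> won, the canonical run for
  \<open>False\<close> would accept as well, against \<open>modes_disjoint\<close>.\<close>

lemma wtree_in_lang_iff:
  "wtree \<in> npta_lang (letters n) arity (mode_trans n) {st True 0} prio \<longleftrightarrow> val Root"
proof
  assume "val Root"
  then show "wtree \<in> npta_lang (letters n) arity (mode_trans n) {st True 0} prio"
    using canonical_run_accepting[of True] is_tree_wtree by (auto simp: npta_lang_def)
next
  assume "wtree \<in> npta_lang (letters n) arity (mode_trans n) {st True 0} prio"
  then obtain \<rho> where \<rho>: "npta_acc_run arity (mode_trans n) {st True 0} prio wtree \<rho>"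
    by (auto simp: npta_lang_def)
  show "val Root"
  proof (rule ccontr)
    assume "\<not> val Root"
    then have acc: "npta_acc_run arity (mode_trans n) {st False 0} prio wtree (\<lambda>u. state (mode False u))"
      using canonical_run_accepting[of False] by simp
    show False
      using modes_disjoint[OF is_tree_wtree \<rho> acc, of "[]" True 0 0] \<rho>
      by (auto simp: wtree_def npta_acc_run_def npta_run_def)
  qed
qed

end

section \<open>Diagonalisation\<close>

lemma apta_hist_append:
  assumes "apta_hist \<sigma> q0 h" "(d, q) \<in> \<sigma> h"
  shows "apta_hist \<sigma> q0 (h @ [(fst (last h) @ [d], q)])"
  unfolding apta_hist_def
proof (intro conjI allI impI)
  fix j assume j: "Suc j < length (h @ [(fst (last h) @ [d], q)])"
  let ?h = "h @ [(fst (last h) @ [d], q)]"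
  show "\<exists>d' q'. ?h ! Suc j = (fst (?h ! j) @ [d'], q') \<and> (d', q') \<in> \<sigma> (take (Suc j) ?h)"
  proof (cases "Suc j < length h")
    case True
    then show ?thesis using assms(1) by (auto simp: apta_hist_def nth_append)
  next
    case False
    then have "Suc j = length h" using j by simp
    moreover from this have "h ! j = last h" by (metis diff_Suc_1 last_conv_nth list.size(3) nat.distinct(1))
    ultimately show ?thesis using assms(2) by (auto simp: nth_append)
  qed
qed (use assms in \<open>auto simp: apta_hist_def\<close>)

lemma apta_hist_snocD:
  assumes "apta_hist \<sigma> q0 (h @ [x])" "h \<noteq> []"
  shows "apta_hist \<sigma> q0 h \<and> (\<exists>d q. x = (fst (last h) @ [d], q) \<and> (d, q) \<in> \<sigma> h)"
proof -
  have step: "\<exists>d q'. (h @ [x]) ! Suc j = (fst ((h @ [x]) ! j) @ [d], q') \<and> (d, q') \<in> \<sigma> (take (Suc j) (h @ [x]))"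
    if "Suc j < length (h @ [x])" for j
    using assms(1) that by (simp add: apta_hist_def)
  have "apta_hist \<sigma> q0 h"
    unfolding apta_hist_def
  proof (intro conjI allI impI)
    show "hd h = ([], q0)" using assms by (simp add: apta_hist_def)
    fix j assume "Suc j < length h"
    then show "\<exists>d q'. h ! Suc j = (fst (h ! j) @ [d], q') \<and> (d, q') \<in> \<sigma> (take (Suc j) h)"
      using step[of j] by (simp add: nth_append)
  qed (rule assms(2))
  moreover obtain j where j: "length h = Suc j" using assms(2) by (cases h) auto
  moreover have "h ! j = last h" using assms(2) j by (simp add: last_conv_nth)
  ultimately show ?thesis using step[of j] by (auto simp: nth_append)
qed

locale apta_game = term_game +
  fixes Q :: "nat set" and \<delta> :: "nat \<Rightarrow> nat \<Rightarrow> (nat \<times> nat) set set"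
  assumes apta: "apta (letters n) arity Q \<delta> q0 om"
    and om_bound: "\<And>q. q \<in> Q \<Longrightarrow> Suc (om q) < n"
    and en: "\<And>q a. q \<in> Q \<Longrightarrow> a \<in> letters n \<Longrightarrow> set ` set (en q a) = \<delta> q a"
begin

section \<open>Resolving one transition of the alternating automaton\<close>

lemma sink_parity:
  assumes "secure s x K" "\<And>b. nx b x = x" "pr x \<noteq> 0"
  shows "even (pr x) = s"
proof -
  define f where "f i = ((\<lambda>\<kappa>. ctx_upd pr \<kappa> x) ^^ i) K" for i
  have good: "x \<in> good s (f i) (Suc n)" if "secure s x (f i)" for i
    using that assms(2) by (auto simp: secure_def pre_def split: if_splits)
  have "secure s x (f i)" for i
  proof (induction i)
    case (Suc i)
    then show ?case using good_step[of s "f i" x] good assms(3) by (simp add: f_def secure_def)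
  qed (simp add: f_def assms(1))
  then show ?thesis
    using good pr_le[of x] assms(3)
    by (intro path_parity[where x = "\<lambda>_. x" and \<kappa> = f and m = "Suc (Suc n)" and start = 0])
      (auto simp: f_def le_imp_less_Suc intro!: exI[of _ "f _"])
qed

definition close :: "(nat \<Rightarrow> trm) \<Rightarrow> (nat \<Rightarrow> trm) \<Rightarrow> bool" where
  "close K K' \<longleftrightarrow> (\<forall>q<n. K' q = K q)"

lemma close_upd: "pr c = n \<Longrightarrow> close K (ctx_upd pr K c)"
  by (simp add: close_def ctx_upd_def)

lemma close_trans: "close K K' \<Longrightarrow> close K' K'' \<Longrightarrow> close K K''"
  by (simp add: close_def)

text \<open>Only an empty list, which makes a sink of small priority, can disturb the context below
  \<open>n\<close>; other intermediate positions have priority \<open>n\<close>.\<close>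

lemma secure_EveCh_tail:
  assumes "secure s (EveCh y \<kappa> p (S # D)) K" "EveCh y \<kappa> n D \<in> good s K (Suc n)"
  shows "\<exists>K'. (D \<noteq> [] \<longrightarrow> close K K') \<and> secure s (EveCh y \<kappa> n D) K'"
  using good_step[of s K "EveCh y \<kappa> n D"] assms n_ge_2
  by (intro exI[of _ "ctx_upd pr K (EveCh y \<kappa> n D)"]) (auto simp: secure_def clamp_eq intro!: close_upd)

lemma secure_EveCh_head:
  assumes "secure s (EveCh y \<kappa> p D) K" "AdamCh y \<kappa> S \<in> good s K (Suc n)"
  shows "\<exists>K'. (S \<noteq> [] \<longrightarrow> close K K') \<and> secure s (AdamCh y \<kappa> S) K'"
  using good_step[of s K "AdamCh y \<kappa> S"] assms n_ge_2
  by (intro exI[of _ "ctx_upd pr K (AdamCh y \<kappa> S)"]) (auto simp: secure_def intro!: close_upd)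

lemma secure_AdamCh_tail:
  assumes "secure s (AdamCh y \<kappa> (dq # S)) K" "AdamCh y \<kappa> S \<in> good s K (Suc n)"
  shows "\<exists>K'. (S \<noteq> [] \<longrightarrow> close K K') \<and> secure s (AdamCh y \<kappa> S) K'"
  using good_step[of s K "AdamCh y \<kappa> S"] assms n_ge_2
  by (intro exI[of _ "ctx_upd pr K (AdamCh y \<kappa> S)"]) (auto simp: secure_def intro!: close_upd)

lemma EveCh_False:
  assumes "secure False (EveCh y \<kappa> p D) K"
  shows "\<exists>S\<in>set D. \<exists>K'. (S \<noteq> [] \<longrightarrow> close K K') \<and> secure False (AdamCh y \<kappa> S) K'"
  using assms
proof (induction D arbitrary: p K)
  case Nil
  then show ?case using sink_parity[of False "EveCh y \<kappa> p []" K] by simp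
next
  case (Cons S D)
  then consider "AdamCh y \<kappa> S \<in> good False K (Suc n)" | "EveCh y \<kappa> n D \<in> good False K (Suc n)"
    by (auto simp: secure_def pre_def split: if_splits)
  then show ?case
  proof cases
    case 1
    then show ?thesis using secure_EveCh_head[OF Cons.prems] by simp
  next
    case 2
    then obtain K' where K': "D \<noteq> [] \<longrightarrow> close K K'" "secure False (EveCh y \<kappa> n D) K'"
      using secure_EveCh_tail[OF Cons.prems] by blast
    then obtain S' K'' where "S' \<in> set D" "S' \<noteq> [] \<longrightarrow> close K' K''" "secure False (AdamCh y \<kappa> S') K''"
      using Cons.IH by blast
    moreover from this have "D \<noteq> []" by auto
    ultimately show ?thesis using K'(1) close_trans by (metis list.set_intros(2))
  qed
qed

lemma EveCh_True:
  assumes "secure True (EveCh y \<kappa> p D) K" "S \<in> set D"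
  shows "\<exists>K'. (S \<noteq> [] \<longrightarrow> close K K') \<and> secure True (AdamCh y \<kappa> S) K'"
  using assms
proof (induction D arbitrary: p K)
  case (Cons S' D)
  then have good: "AdamCh y \<kappa> S' \<in> good True K (Suc n)" "EveCh y \<kappa> n D \<in> good True K (Suc n)"
    by (auto simp: secure_def pre_def all_bool_eq)
  show ?case
  proof (cases "S = S'")
    case True
    then show ?thesis using secure_EveCh_head[OF Cons.prems(1)] good by simp
  next
    case False
    then have D: "S \<in> set D" using Cons.prems by simp
    obtain K' where K': "D \<noteq> [] \<longrightarrow> close K K'" "secure True (EveCh y \<kappa> n D) K'"
      using secure_EveCh_tail[OF Cons.prems(1) good(2)] by blast
    moreover obtain K'' where "S \<noteq> [] \<longrightarrow> close K' K''" "secure True (AdamCh y \<kappa> S) K''"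
      using Cons.IH[OF K'(2) D] by blast
    moreover have "D \<noteq> []" using D by auto
    ultimately show ?thesis using close_trans by blast
  qed
qed simp

text \<open>One move of the automaton as a single step in the sense of \<open>path_parity\<close>
  with \<open>m = n\<close>; \<open>K1\<close> absorbs the changes made by the intermediate
  choices.\<close>

definition link :: "bool \<Rightarrow> (nat \<Rightarrow> trm) \<Rightarrow> trm \<Rightarrow> (nat \<Rightarrow> trm) \<Rightarrow> bool" where
  "link s K c K' \<longleftrightarrow> secure s c K' \<and> (\<exists>K1. close K K1 \<and> c \<in> good s K1 (Suc n) \<and> K' = ctx_upd pr K1 c)"

lemma link_close: "close K K' \<Longrightarrow> link s K' c K'' \<Longrightarrow> link s K c K''"
  unfolding link_def using close_trans by blast

lemma link_enter:
  assumes "secure s x K" "enter z q \<in> good s K (Suc n)"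
  shows "\<exists>K'. link s K (enter z q) K'"
proof -
  have "pr (enter z q) \<noteq> 0" by (simp add: enter_def clamp_def less_max_iff_disj)
  then show ?thesis
    using assms good_step[of s K "enter z q"] unfolding link_def close_def secure_def by blast
qed

lemma AdamCh_False:
  assumes "secure False (AdamCh y \<kappa> S) K" "(d, q) \<in> set S"
  shows "\<exists>K'. link False K (enter (child d (y, \<kappa>)) q) K'"
  using assms
proof (induction S arbitrary: K)
  case (Cons dq S)
  then have good: "enter (child (fst dq) (y, \<kappa>)) (snd dq) \<in> good False K (Suc n)" "AdamCh y \<kappa> S \<in> good False K (Suc n)"
    by (auto simp: secure_def pre_def all_bool_eq child_def)
  show ?case
  proof (cases "dq = (d, q)")
    case True
    then show ?thesis using link_enter[OF Cons.prems(1) good(1)] by simp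
  next
    case False
    then have S: "(d, q) \<in> set S" using Cons.prems by auto
    then obtain K' where "close K K'" "secure False (AdamCh y \<kappa> S) K'"
      using secure_AdamCh_tail[OF Cons.prems(1) good(2)] by auto
    then show ?thesis using Cons.IH[OF _ S] link_close by blast
  qed
qed simp

lemma AdamCh_True:
  assumes "secure True (AdamCh y \<kappa> S) K"
  shows "\<exists>(d, q)\<in>set S. \<exists>K'. link True K (enter (child d (y, \<kappa>)) q) K'"
  using assms
proof (induction S arbitrary: K)
  case Nil
  then show ?case using sink_parity[of True "AdamCh y \<kappa> []" K] by simp
next
  case (Cons dq S)
  then consider "enter (child (fst dq) (y, \<kappa>)) (snd dq) \<in> good True K (Suc n)" | "AdamCh y \<kappa> S \<in> good True K (Suc n)"
    by (auto simp: secure_def pre_def child_def split: if_splits)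
  then show ?case
  proof cases
    case 1
    then show ?thesis using link_enter[OF Cons.prems] by (auto simp: case_prod_beta)
  next
    case 2
    then obtain K' where K': "S \<noteq> [] \<longrightarrow> close K K'" "secure True (AdamCh y \<kappa> S) K'"
      using secure_AdamCh_tail[OF Cons.prems] by blast
    then obtain d q K'' where "(d, q) \<in> set S" "link True K' (enter (child d (y, \<kappa>)) q) K''"
      using Cons.IH by blast
    moreover from this have "S \<noteq> []" by auto
    ultimately show ?thesis using K'(1) link_close by fastforce
  qed
qed

lemma eve_move:
  assumes "q \<in> Q" "secure False (enter (node u) q) K"
  shows "\<exists>S\<in>\<delta> q (lab (fst (node u))). \<forall>(d, q')\<in>S. \<exists>K'. link False K (enter (node (u @ [d])) q') K'"
proof -
  let ?D = "en q (lab (fst (node u)))"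
  obtain S K' where S: "S \<in> set ?D" "S \<noteq> [] \<longrightarrow> close K K'"
    "secure False (AdamCh (fst (node u)) (snd (node u)) S) K'"
    using EveCh_False assms(2) unfolding enter_def by blast
  have "\<exists>K''. link False K (enter (node (u @ [d])) q') K''" if "(d, q') \<in> set S" for d q'
  proof -
    have "close K K'" using S(2) that by auto
    then show ?thesis using AdamCh_False[OF S(3) that] link_close by fastforce
  qed
  moreover have "set S \<in> \<delta> q (lab (fst (node u)))" using en[OF assms(1) lab_letters] S(1) by blast
  ultimately show ?thesis by blast
qed

lemma adam_move:
  assumes "q \<in> Q" "secure True (enter (node u) q) K" "S \<in> \<delta> q (lab (fst (node u)))"
  shows "\<exists>(d, q')\<in>S. \<exists>K'. link True K (enter (node (u @ [d])) q') K'"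
proof -
  obtain S' where S': "S' \<in> set (en q (lab (fst (node u))))" "S = set S'"
    using en[OF assms(1) lab_letters] assms(3) by blast
  then obtain K' where K': "S' \<noteq> [] \<longrightarrow> close K K'" "secure True (AdamCh (fst (node u)) (snd (node u)) S') K'"
    using EveCh_True assms(2) unfolding enter_def by blast
  obtain d q' K'' where dq: "(d, q') \<in> set S'" "link True K' (enter (node (u @ [d])) q') K''"
    using AdamCh_True[OF K'(2)] by auto
  then have "S' \<noteq> []" by auto
  then have "link True K (enter (node (u @ [d])) q') K''" using dq K'(1) link_close by blast
  then show ?thesis using dq(1) S'(2) by blast
qed

text \<open>Nonempty transition formulas exclude sinks, so the positions seen have priority
  \<open>Suc (om q)\<close>, below \<open>n\<close>; the shift by one turns \<open>s\<close> into
  its negation.\<close>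

lemma macro_parity:
  assumes "\<And>m. snd (p m) \<in> Q" "\<And>m. \<delta> (snd (p m)) (lab (fst (node (fst (p m))))) \<noteq> {}"
    and link: "\<And>m. link s (K m) (enter (node (fst (p (Suc m)))) (snd (p (Suc m)))) (K (Suc m))"
  shows "parity_acc (\<lambda>m. om (snd (p m))) \<longleftrightarrow> \<not> s"
proof -
  define x where "x m = enter (node (fst (p m))) (snd (p m))" for m
  have "en (snd (p m)) (lab (fst (node (fst (p m))))) \<noteq> []" for m
    using en[OF assms(1)[of m] lab_letters[of "fst (node (fst (p m)))"]] assms(2)[of m] by force
  then have pr_x: "pr (x m) = Suc (om (snd (p m)))" for m
    using om_bound[OF assms(1)[of m]] by (simp add: x_def enter_def clamp_eq)
  then have limp: "limp (\<lambda>m. pr (x m)) = limp (\<lambda>m. om (snd (p m))) + 1"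
    using om_bound[OF assms(1)] by (intro limp_affine_tail[where d = 0 and M = 0 and B = n]) (auto simp: less_imp_le Suc_lessD)
  have inf: "infinite {m. pr (x m) = limp (\<lambda>m. pr (x m))}" by (rule limp_infinite[OF pr_le])
  then obtain m where "pr (x m) = limp (\<lambda>m. pr (x m))" using infinite_imp_nonempty by blast
  then have lt: "limp (\<lambda>m. pr (x m)) < n" "limp (\<lambda>m. pr (x m)) \<noteq> 0"
    using pr_x[of m] om_bound[OF assms(1)[of m]] by auto
  obtain M where M: "\<And>m. m \<ge> M \<Longrightarrow> limp (\<lambda>m. pr (x m)) \<le> pr (x m)" using limp_eventually_le by blast
  have "even (limp (\<lambda>m. pr (x m))) = s"
  proof (rule path_parity[where start = M and \<kappa> = K and x = x, OF _ lt(2,1) _ inf])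
    fix m
    show "\<exists>\<kappa>'. (\<forall>q<n. \<kappa>' q = K m q) \<and> x (Suc m) \<in> good s \<kappa>' (Suc n) \<and> K (Suc m) = ctx_upd pr \<kappa>' (x (Suc m))"
      using link[of m] unfolding link_def close_def x_def by blast
    assume "M \<le> m"
    then show "limp (\<lambda>m. pr (x m)) \<le> pr (x (Suc m))" using M by simp
  qed
  then show ?thesis using limp by (auto simp: parity_acc_limp)
qed

section \<open>The acceptance game on the diagonal tree\<close>

lemma secure_start: "secure (val Root) (enter (node []) q0) (fresh (enter (node []) q0) (val Root))"
proof -
  let ?x = "enter (node []) q0"
  have pr: "pr ?x \<noteq> 0" by (simp add: enter_def clamp_def less_max_iff_disj)
  have "val ?x = val Root"
  proof -
    have "Root \<in> win True 1 (zeros True) \<longleftrightarrow> ?x \<in> win True 1 (zeros True)"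
      using pr by (subst win_pre) (auto simp: pre_def)
    then show ?thesis using val_iff_win[of Root True] val_iff_win[of ?x True] pr by simp
  qed
  then show ?thesis using sound_fresh[of ?x "val Root"] pr by (simp add: sound_def)
qed

lemma delta_move:
  assumes "q \<in> Q" "valid u" "S \<in> \<delta> q (lab (fst (node u)))" "(d, q') \<in> S"
  shows "valid (u @ [d])" "q' \<in> Q"
  using apta assms lab_letters[of "fst (node u)"] unfolding apta_def by fastforce+

lemma q0_in_Q: "q0 \<in> Q"
  using apta by (simp add: apta_def)

text \<open>Adam answers the given strategy by moving to good positions of \<open>True\<close>.
  Dependent choice builds the history together with its context, and the resulting play violates the
  parity condition.\<close>

lemma adam_beats:
  assumes "val Root" "apta_winning \<delta> q0 om wtree \<sigma>"
  shows False
proof -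
  let ?P = "\<lambda>m hK. apta_hist \<sigma> q0 (fst hK) \<and> (m = 0 \<longrightarrow> fst hK = [([], q0)]) \<and> valid (fst (last (fst hK))) \<and>
    snd (last (fst hK)) \<in> Q \<and> secure True (enter (node (fst (last (fst hK)))) (snd (last (fst hK)))) (snd hK)"
  let ?R = "\<lambda>hK hK'. \<exists>d q. (d, q) \<in> \<sigma> (fst hK) \<and> fst hK' = fst hK @ [(fst (last (fst hK)) @ [d], q)] \<and>
    link True (snd hK) (enter (node (fst (last (fst hK)) @ [d])) q) (snd hK')"
  have win: "\<sigma> h \<in> \<delta> (snd (last h)) (lab (fst (node (fst (last h)))))"
    if "apta_hist \<sigma> q0 h" "valid (fst (last h))" for h
    using assms(2) that by (auto simp: apta_winning_def wtree_def)
  have "\<exists>f. \<forall>m. ?P m (f m) \<and> ?R (f m) (f (Suc m))"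
  proof (rule dependent_nat_choice)
    show "\<exists>hK. ?P 0 hK"
      using secure_start assms(1) q0_in_Q
      by (intro exI[of _ "([([], q0)], fresh (enter (node []) q0) True)"]) (simp add: apta_hist_def)
  next
    fix hK and m :: nat assume P: "?P m hK"
    obtain h K where hK: "hK = (h, K)" by fastforce
    obtain u q where uq: "last h = (u, q)" by fastforce
    have S: "\<sigma> h \<in> \<delta> q (lab (fst (node u)))" using win[of h] P hK uq by simp
    then obtain d q' K' where d: "(d, q') \<in> \<sigma> h" "link True K (enter (node (u @ [d])) q') K'"
      using adam_move[of q u K "\<sigma> h"] P hK uq by auto
    have "?P (Suc m) (h @ [(u @ [d], q')], K')"
      using apta_hist_append[of \<sigma> q0 h d q'] d P hK uq delta_move[OF _ _ S d(1)] by (auto simp: link_def)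
    moreover have "?R hK (h @ [(u @ [d], q')], K')" using d hK uq by auto
    ultimately show "\<exists>hK'. ?P (Suc m) hK' \<and> ?R hK hK'" by blast
  qed
  then obtain f where choice: "\<forall>m. ?P m (f m) \<and> ?R (f m) (f (Suc m))" ..
  note f = conjunct1[OF spec[OF choice]] conjunct2[OF spec[OF choice]]
  define p where "p m = last (fst (f m))" for m
  have hist: "fst (f m) = map p [0..<Suc m]" for m
  proof (induction m)
    case 0
    then show ?case using f(1)[of 0] by (simp add: p_def)
  next
    case (Suc m)
    then show ?case using f(2)[of m] by (auto simp: p_def)
  qed
  have step: "\<exists>d q'. p (Suc m) = (fst (p m) @ [d], q') \<and> (d, q') \<in> \<sigma> (map p [0..<Suc m])" for m
    using f(2)[of m] unfolding hist[symmetric] by (auto simp: p_def)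
  have "p 0 = ([], q0)" using f(1)[of 0] by (simp add: p_def)
  then have "parity_acc (\<lambda>m. om (snd (p m)))"
    using assms(2) step unfolding apta_winning_def by blast
  moreover have "parity_acc (\<lambda>m. om (snd (p m))) \<longleftrightarrow> \<not> True"
  proof (rule macro_parity)
    fix m
    show "snd (p m) \<in> Q" using f(1)[of m] by (simp add: p_def)
    show "\<delta> (snd (p m)) (lab (fst (node (fst (p m))))) \<noteq> {}"
      using win[of "fst (f m)"] f(1)[of m] by (auto simp: p_def)
    show "link True (snd (f m)) (enter (node (fst (p (Suc m)))) (snd (p (Suc m)))) (snd (f (Suc m)))"
      using f(2)[of m] by (auto simp: p_def)
  qed
  ultimately show False by simp
qed

text \<open>A strategy sees only the history, so the context of \<open>False\<close> is recomputed
  from it by fixed choices; these exist along every history consistent with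
  \<open>eve_strat\<close>.\<close>

definition eve_ctx :: "(nat list \<times> nat) list \<Rightarrow> nat \<Rightarrow> trm" where
  "eve_ctx h = foldl (\<lambda>K x. SOME K'. link False K (enter (node (fst x)) (snd x)) K')
     (fresh (enter (node []) q0) False) (tl h)"

definition eve_strat :: "(nat list \<times> nat) list \<Rightarrow> (nat \<times> nat) set" where
  "eve_strat h = (SOME S. S \<in> \<delta> (snd (last h)) (lab (fst (node (fst (last h))))) \<and>
     (\<forall>(d, q)\<in>S. \<exists>K'. link False (eve_ctx h) (enter (node (fst (last h) @ [d])) q) K'))"

lemma eve_strat_spec:
  assumes "snd (last h) \<in> Q" "secure False (enter (node (fst (last h))) (snd (last h))) (eve_ctx h)"
  shows "eve_strat h \<in> \<delta> (snd (last h)) (lab (fst (node (fst (last h)))))"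
    and "(d, q) \<in> eve_strat h \<Longrightarrow> \<exists>K'. link False (eve_ctx h) (enter (node (fst (last h) @ [d])) q) K'"
proof -
  have "\<exists>S. S \<in> \<delta> (snd (last h)) (lab (fst (node (fst (last h))))) \<and>
     (\<forall>(d, q)\<in>S. \<exists>K'. link False (eve_ctx h) (enter (node (fst (last h) @ [d])) q) K')"
    using eve_move[OF assms] by blast
  from someI_ex[OF this, folded eve_strat_def]
  show "eve_strat h \<in> \<delta> (snd (last h)) (lab (fst (node (fst (last h)))))"
    and "(d, q) \<in> eve_strat h \<Longrightarrow> \<exists>K'. link False (eve_ctx h) (enter (node (fst (last h) @ [d])) q) K'"
    by auto
qed

lemma eve_ctx_link:
  assumes "h \<noteq> []" "\<exists>K'. link False (eve_ctx h) (enter (node (fst x)) (snd x)) K'"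
  shows "link False (eve_ctx h) (enter (node (fst x)) (snd x)) (eve_ctx (h @ [x]))"
proof -
  have "eve_ctx (h @ [x]) = (SOME K'. link False (eve_ctx h) (enter (node (fst x)) (snd x)) K')"
    using assms(1) by (simp add: eve_ctx_def)
  then show ?thesis using someI_ex[OF assms(2)] by simp
qed

lemma eve_hist:
  assumes "\<not> val Root" "apta_hist eve_strat q0 h"
  shows "valid (fst (last h)) \<and> snd (last h) \<in> Q \<and>
    secure False (enter (node (fst (last h))) (snd (last h))) (eve_ctx h)"
  using assms(2)
proof (induction h rule: rev_induct)
  case Nil
  then show ?case by (simp add: apta_hist_def)
next
  case (snoc x h)
  show ?case
  proof (cases "h = []")
    case True
    then have "x = ([], q0)" using snoc.prems by (simp add: apta_hist_def)
    then show ?thesis using True secure_start assms(1) q0_in_Q by (simp add: eve_ctx_def)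
  next
    case False
    then obtain d q where x: "x = (fst (last h) @ [d], q)" "(d, q) \<in> eve_strat h" and h: "apta_hist eve_strat q0 h"
      using apta_hist_snocD[OF snoc.prems] by blast
    note IH = snoc.IH[OF h]
    have "link False (eve_ctx h) (enter (node (fst x)) (snd x)) (eve_ctx (h @ [x]))"
      using eve_strat_spec(2)[of h d q] IH x by (intro eve_ctx_link[OF False]) auto
    moreover have "valid (fst x)" "snd x \<in> Q"
      using delta_move[of "snd (last h)" "fst (last h)" "eve_strat h" d q] IH x eve_strat_spec(1)[of h] by auto
    ultimately show ?thesis by (simp add: link_def)
  qed
qed

lemma eve_strat_winning:
  assumes "\<not> val Root"
  shows "apta_winning \<delta> q0 om wtree eve_strat"
  unfolding apta_winning_def
proof (intro conjI allI impI)
  fix h assume "apta_hist eve_strat q0 h"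
  then show "eve_strat h \<in> \<delta> (snd (last h)) (the (wtree (fst (last h))))"
    using eve_hist[OF assms, of h] eve_strat_spec(1)[of h] by (simp add: wtree_def)
next
  fix p assume p: "p 0 = ([], q0) \<and>
    (\<forall>m. \<exists>d q'. p (Suc m) = (fst (p m) @ [d], q') \<and> (d, q') \<in> eve_strat (map p [0..<Suc m]))"
  have hist: "apta_hist eve_strat q0 (map p [0..<Suc m])" for m
  proof (induction m)
    case 0
    then show ?case using p by (simp add: apta_hist_def)
  next
    case (Suc m)
    obtain d q' where "p (Suc m) = (fst (p m) @ [d], q')" "(d, q') \<in> eve_strat (map p [0..<Suc m])"
      using p by blast
    then show ?case using apta_hist_append[OF Suc] by simp
  qed
  have last: "last (map p [0..<Suc m]) = p m" for m by simp
  have "parity_acc (\<lambda>m. om (snd (p m))) \<longleftrightarrow> \<not> False"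
  proof (rule macro_parity)
    fix m
    note inv = eve_hist[OF assms hist[of m], unfolded last]
    show "snd (p m) \<in> Q" using inv by blast
    have spec: "eve_strat (map p [0..<Suc m]) \<in> \<delta> (snd (p m)) (lab (fst (node (fst (p m)))))"
      "(d, q) \<in> eve_strat (map p [0..<Suc m]) \<Longrightarrow>
         \<exists>K'. link False (eve_ctx (map p [0..<Suc m])) (enter (node (fst (p m) @ [d])) q) K'" for d q
      using eve_strat_spec(1)[of "map p [0..<Suc m]", unfolded last]
        eve_strat_spec(2)[of "map p [0..<Suc m]" d q, unfolded last] inv by auto
    show "\<delta> (snd (p m)) (lab (fst (node (fst (p m))))) \<noteq> {}" using spec(1) by blast
    obtain d q' where d: "p (Suc m) = (fst (p m) @ [d], q')" "(d, q') \<in> eve_strat (map p [0..<Suc m])"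
      using p by blast
    have "link False (eve_ctx (map p [0..<Suc m])) (enter (node (fst (p (Suc m)))) (snd (p (Suc m))))
        (eve_ctx (map p [0..<Suc m] @ [p (Suc m)]))"
      using spec(2)[OF d(2)] d(1) by (intro eve_ctx_link) auto
    then show "link False (eve_ctx (map p [0..<Suc m])) (enter (node (fst (p (Suc m)))) (snd (p (Suc m))))
        (eve_ctx (map p [0..<Suc (Suc m)]))" by simp
  qed
  then show "parity_acc (\<lambda>m. om (snd (p m)))" by simp
qed

lemma wtree_in_apta_lang_iff: "wtree \<in> apta_lang (letters n) arity \<delta> q0 om \<longleftrightarrow> \<not> val Root"
  using adam_beats eve_strat_winning is_tree_wtree by (auto simp: apta_lang_def)

end

theorem theorem1:
  fixes i k :: nat
  assumes "i < k"
  shows "\<exists>A ar Q \<Delta> I \<Omega>. finite A \<and> npta A ar Q \<Delta> I \<Omega> \<and> npta_unambiguous A ar \<Delta> I \<Omega> \<and>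
           \<not> (\<exists>Q' \<delta> q0 \<Omega>'. apta A ar Q' \<delta> q0 \<Omega>' \<and> (\<forall>q\<in>Q'. \<Omega>' q \<in> {i..k}) \<and>
                apta_lang A ar \<delta> q0 \<Omega>' = npta_lang A ar \<Delta> I \<Omega>)"
proof -
  define n where "n = k + 2"
  have "False" if apta: "apta (letters n) arity Q' \<delta> q0 \<Omega>'" and k: "\<forall>q\<in>Q'. \<Omega>' q \<in> {i..k}"
    and lang: "apta_lang (letters n) arity \<delta> q0 \<Omega>' = npta_lang (letters n) arity (mode_trans n) {st True 0} prio"
    for Q' \<delta> q0 \<Omega>'
  proof -
    define en where "en q a = (SOME D. set ` set D = \<delta> q a)" for q a
    have en: "set ` set (en q a) = \<delta> q a" if "q \<in> Q'" "a \<in> letters n" for q a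
    proof -
      have "finite (\<delta> q a)" "\<forall>S\<in>\<delta> q a. S \<subseteq> {0..<arity a} \<times> Q'" "finite Q'"
        using apta that by (auto simp: apta_def)
      then have "\<forall>S\<in>\<delta> q a. \<exists>xs. set xs = S" using finite_list finite_subset by (metis finite_SigmaI finite_atLeastLessThan)
      then obtain xs where xs: "\<forall>S\<in>\<delta> q a. set (xs S) = S" by metis
      obtain Ss where "set Ss = \<delta> q a" using finite_list[OF \<open>finite (\<delta> q a)\<close>] by blast
      then have "set ` set (map xs Ss) = \<delta> q a" using xs by (simp add: image_image)
      then show ?thesis unfolding en_def by (rule someI)
    qed
    \<comment> \<open>The automaton to be refuted is itself the parameter of the game, so its
      diagonal tree lies in exactly one of the two languages.\<close>
    interpret apta_game n en \<Omega>' q0 Q' \<delta>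
      by unfold_locales (use apta k en in \<open>auto simp: n_def\<close>)
    show False using wtree_in_apta_lang_iff wtree_in_lang_iff lang by simp
  qed
  moreover have "finite (letters n)" by (simp add: letters_def)
  ultimately show ?thesis
    using npta_mode_trans[of n] unambiguous_mode_trans[of n] by metis
qed

end
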